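(* Let $M,\widehat M$ be oriented connected $n$-dimensional Riemannian manifolds isometrically imbedded in $\mathbb{R}^{n+\nu}$, and let $(x,g):[0,\tau]\to M\times \mathrm{Isom}^+(\mathbb{R}^{n+\nu})$ be an absolutely continuous curve. Write $\widehat x(t):=g(t)x(t)$. Then the following two sets of conditions are equivalent. First set: (i) $\widehat x(t)\in\widehat M$ for all $t\in[0,\tau]$; (ii) $T_{\widehat x(t)}(g(t)M)=T_{\widehat x(t)}\widehat M$ for all $t\in[0,\tau]$; (iii) $\dot g(t)\circ g^{-1}(t)\,\widehat x(t)=0$ for almost every $t$; (iv) $d(\dot g(t)\circ g^{-1}(t))(T_{\widehat x(t)}\widehat M)\subseteq T_{\widehat x(t)}\widehat M^\perp$ for almost every $t$; (v) $d(\dot g(t)\circ g^{-1}(t))(T_{\widehat x(t)}\widehat M^\perp)\subseteq T_{\widehat x(t)}\widehat M$ for almost every $t$; (vi) $d_{x(t)}g(t)|_{T_{x(t)}M}:T_{x(t)}M\to T_{\widehat x(t)}\widehat M$ is orientation preserving for all $t\in[0,\tau]$. Second set: (i') $\widehat x(t)\in\widehat M$ for all $t$; (ii') $dg(t)\,T_{x(t)}M=T_{\widehat x(t)}\widehat M$ for all $t$; (iii') $\dot{\widehat x}(t)=dg(t)\,\dot x(t)$ for almost every $t$; (iv') $dg(t)\frac{D}{dt}Z(t)=\frac{D}{dt}\,dg(t)Z(t)$ for any tangent vector field $Z(t)$ along $x(t)$ and almost every $t$; (v') $dg(t)\frac{D^\perp}{dt}\Psi(t)=\frac{D^\perp}{dt}\,dg(t)\Psi(t)$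 for any normal vector field $\Psi(t)$ along $x(t)$ and almost every $t$; (vi') $d_{x(t)}g(t)|_{T_{x(t)}M}:T_{x(t)}M\to T_{\widehat x(t)}\widehat M$ is orientation preserving for all $t$.
   Context: $\mathbb{R}^{n+\nu}$ carries the standard Euclidean metric and orientation; $M,\widehat M$ are identified with their images. $\mathrm{Isom}^+(\mathbb{R}^{n+\nu})$ is the group of orientation preserving isometries; an element $g(t)$ is written $\bar x\mapsto \bar A(t)\bar x+\bar r(t)$ with $\bar A(t)\in \mathrm{SO}(n+\nu)$, $\bar r(t)\in\mathbb{R}^{n+\nu}$, so $dg(t)=\bar A(t)$. Where the derivative exists, $\dot g(t)$ is the affine map $\bar x\mapsto\dot{\bar A}(t)\bar x+\dot{\bar r}(t)$, and $d(\dot g(t)\circ g^{-1}(t))$ is its composition's linear part $\dot{\bar A}(t)\bar A(t)^{-1}$, acting on vectors of $\mathbb{R}^{n+\nu}$ (all tangent spaces of $\mathbb{R}^{n+\nu}$ are identified with $\mathbb{R}^{n+\nu}$). For $x\in M$, $T_x\mathbb{R}^{n+\nu}=T_xM\oplus T_xM^\perp$, and a vector splits as $v=v^\top+v^\perp$; similarly for $\widehat M$. For (absolutely continuous) tangent vector fields $Z(t)$, respectively normal vector fields $\Psi(t)$, along a curve in $M$ (or $\widehat M$), the covariant derivative and normal covariant derivative are $\frac{D}{dt}Z(t)=(\frac{d}{dt}Z(t))^\top$ and $\frac{D^\perp}{dt}\Psi(t)=(\frac{d}{dt}\Psi(t))^\perp$. *)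

theory Defs
  imports "HOL-Analysis.Analysis"
begin

text \<open>\<open>Ck_on k S f\<close> is intended for open \<open>S\<close>. On a finite-dimensional domain, continuity of all
  directional derivatives of order \<open>k\<close> is continuity of the \<open>k\<close>-th derivative.\<close>

primrec Ck_on :: "nat \<Rightarrow> 'a::real_normed_vector set \<Rightarrow> ('a \<Rightarrow> 'b::real_normed_vector) \<Rightarrow> bool" where
  "Ck_on 0 S f \<longleftrightarrow> continuous_on S f"
| "Ck_on (Suc k) S f \<longleftrightarrow>
     (\<forall>p\<in>S. f differentiable (at p)) \<and> (\<forall>v. Ck_on k S (\<lambda>p. frechet_derivative f (at p) v))"

definition smooth_on :: "'a::real_normed_vector set \<Rightarrow> ('a \<Rightarrow> 'b::real_normed_vector) \<Rightarrow> bool" where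
  "smooth_on S f \<longleftrightarrow> (\<forall>k. Ck_on k S f)"

text \<open>The slice-chart condition. A manifold isometrically imbedded in Euclidean space is identified
  with its image, which carries the subspace topology and the induced metric.\<close>

definition embedded_submanifold :: "nat \<Rightarrow> 'a::euclidean_space set \<Rightarrow> bool" where
  "embedded_submanifold n M \<longleftrightarrow>
     (\<forall>p\<in>M. \<exists>U V (\<phi> :: 'a \<Rightarrow> 'a) \<psi> L.
        open U \<and> open V \<and> p \<in> U \<and> homeomorphism U V \<phi> \<psi> \<and> smooth_on U \<phi> \<and> smooth_on V \<psi> \<and>
        subspace L \<and> dim L = n \<and> \<phi> ` (M \<inter> U) = L \<inter> V)"

definition tangent_space :: "'a::euclidean_space set \<Rightarrow> 'a \<Rightarrow> 'a set" where
  "tangent_space M p =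
     {v. \<exists>(\<gamma> :: real \<Rightarrow> 'a) \<epsilon>. \<epsilon> > 0 \<and> \<gamma> differentiable_on {-\<epsilon><..<\<epsilon>} \<and> \<gamma> ` {-\<epsilon><..<\<epsilon>} \<subseteq> M \<and>
           \<gamma> 0 = p \<and> (\<gamma> has_vector_derivative v) (at 0)}"

abbreviation normal_space_at :: "'a::euclidean_space set \<Rightarrow> 'a \<Rightarrow> 'a set" where
  "normal_space_at M p \<equiv> (tangent_space M p)\<^sup>\<bottom>"

definition ordered_basis :: "'a::euclidean_space set \<Rightarrow> 'a list \<Rightarrow> bool" where
  "ordered_basis T bs \<longleftrightarrow> distinct bs \<and> independent (set bs) \<and> span (set bs) = T"

text \<open>The change of basis, an automorphism of \<open>T\<close>, is extended by the identity on the orthogonal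
  complement of \<open>T\<close>; this does not alter its determinant.\<close>

definition same_orientation :: "(real^'N) set \<Rightarrow> (real^'N) list \<Rightarrow> (real^'N) list \<Rightarrow> bool" where
  "same_orientation T bs cs \<longleftrightarrow>
     (\<exists>f. linear f \<and> map f bs = cs \<and> (\<forall>v\<in>T\<^sup>\<bottom>. f v = v) \<and> det (matrix f) > 0)"

text \<open>\<open>Or p\<close> is the set of positively oriented ordered bases of the tangent space at \<open>p\<close>. In
  dimension \<open>0\<close> the only ordered basis is \<open>[]\<close>; the two orientations of a point are then
  \<open>{[]}\<close> (positive) and \<open>{}\<close> (negative), which is why non-membership is allowed for the local
  frame below.\<close>

definition orientation_on :: "(real^'N) set \<Rightarrow> (real^'N \<Rightarrow> (real^'N) list set) \<Rightarrow> bool" where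
  "orientation_on M Or \<longleftrightarrow>
     (\<forall>p\<in>M. Or p \<subseteq> Collect (ordered_basis (tangent_space M p)) \<and>
        (\<forall>bs cs. ordered_basis (tangent_space M p) bs \<and> ordered_basis (tangent_space M p) cs \<longrightarrow>
           ((bs \<in> Or p \<longleftrightarrow> cs \<in> Or p) \<longleftrightarrow> same_orientation (tangent_space M p) bs cs))) \<and>
     (\<forall>p\<in>M. \<exists>U es. open U \<and> p \<in> U \<and> (\<forall>e\<in>set es. continuous_on (M \<inter> U) e) \<and>
        (\<forall>q\<in>M \<inter> U. ordered_basis (tangent_space M q) (map (\<lambda>e. e q) es)) \<and>
        ((\<forall>q\<in>M \<inter> U. map (\<lambda>e. e q) es \<in> Or q) \<or> (\<forall>q\<in>M \<inter> U. map (\<lambda>e. e q) es \<notin> Or q)))"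

text \<open>Here \<open>f\<close> is meant to map \<open>T\<close> isomorphically onto the oriented space whose positive bases are
  \<open>Q\<close>; \<open>P\<close> is the set of positive bases of \<open>T\<close>.\<close>

definition orientation_preserving ::
  "(real^'N) set \<Rightarrow> (real^'N) list set \<Rightarrow> (real^'N) list set \<Rightarrow> (real^'N \<Rightarrow> real^'N) \<Rightarrow> bool" where
  "orientation_preserving T P Q f \<longleftrightarrow> (\<forall>bs. ordered_basis T bs \<longrightarrow> (bs \<in> P \<longleftrightarrow> map f bs \<in> Q))"

text \<open>For an affine map \<open>h\<close>, \<open>linear_part h\<close> is the matrix of its differential (at any point) and
  \<open>h 0\<close> is its translation part.\<close>

definition linear_part :: "(real^'N \<Rightarrow> real^'N) \<Rightarrow> real^'N^'N" where
  "linear_part h = matrix (\<lambda>v. h v - h 0)"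

definition Isom_plus :: "(real^'N \<Rightarrow> real^'N) set" where
  "Isom_plus = {g. (\<forall>p q. dist (g p) (g q) = dist p q) \<and> (\<forall>p. det (jacobian g (at p)) > 0)}"

lemma linear_part_affine [simp]: "linear_part (\<lambda>p. A *v p + r) = A"
  by (simp add: linear_part_def)

lemma has_derivative_affine:
  fixes A :: "real^'N^'N"
  shows "((\<lambda>p. A *v p + r) has_derivative (\<lambda>v. A *v v)) (at p)"
  by (auto intro!: derivative_eq_intros bounded_linear_imp_has_derivative matrix_vector_mul_bounded_linear)

lemma jacobian_affine:
  fixes A :: "real^'N^'N"
  shows "jacobian (\<lambda>p. A *v p + r) (at p) = A"
  by (simp add: jacobian_def frechet_derivative_at[OF has_derivative_affine, symmetric])

lemma Isom_plus_iff:
  "g \<in> Isom_plus \<longleftrightarrow> (\<exists>A r. rotation_matrix A \<and> g = (\<lambda>p. A *v p + r))"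
proof
  assume g: "g \<in> Isom_plus"
  define f where "f = (\<lambda>v. g v - g 0)"
  have "\<forall>p q. dist (f p) (f q) = dist p q"
    using g by (simp add: f_def Isom_plus_def dist_norm)
  then have orth: "orthogonal_transformation f"
    using orthogonal_transformation_isometry[of f] by (simp add: f_def)
  then have g_eq: "g = (\<lambda>p. matrix f *v p + g 0)"
    by (simp add: fun_eq_iff matrix_works orthogonal_transformation_linear) (simp add: f_def)
  have "orthogonal_matrix (matrix f)"
    using orth orthogonal_transformation_matrix by blast
  moreover have "det (matrix f) > 0"
    using g jacobian_affine[of "matrix f" "g 0" 0] unfolding g_eq[symmetric]
    by (metis (mono_tags, lifting) Isom_plus_def mem_Collect_eq)
  ultimately have "rotation_matrix (matrix f)"
    using det_orthogonal_matrix[of "matrix f"] by (auto simp: rotation_matrix_def)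
  then show "\<exists>A r. rotation_matrix A \<and> g = (\<lambda>p. A *v p + r)"
    using g_eq by blast
next
  assume "\<exists>A r. rotation_matrix A \<and> g = (\<lambda>p. A *v p + r)"
  then obtain A r where A: "orthogonal_matrix A" "det A = 1" and g: "g = (\<lambda>p. A *v p + r)"
    by (auto simp: rotation_matrix_def)
  have "orthogonal_transformation ((*v) A)"
    using A by (simp add: orthogonal_transformation_matrix)
  then have "norm (A *v (p - q)) = norm (p - q)" for p q
    by (rule orthogonal_transformation_norm)
  then show "g \<in> Isom_plus"
    using A by (simp add: Isom_plus_def g jacobian_affine dist_norm matrix_vector_mult_diff_distrib)
qed

lemma Isom_plus_linear_part:
  assumes "g \<in> Isom_plus"
  shows "rotation_matrix (linear_part g)"
    and "g p = linear_part g *v p + g 0"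
    and "(g has_derivative (\<lambda>v. linear_part g *v v)) (at p)"
proof -
  obtain A r where "rotation_matrix A" "g = (\<lambda>p. A *v p + r)"
    using assms Isom_plus_iff by blast
  then show "rotation_matrix (linear_part g)" "g p = linear_part g *v p + g 0"
    "(g has_derivative (\<lambda>v. linear_part g *v v)) (at p)"
    by (simp_all add: has_derivative_affine)
qed

definition abs_continuous_on :: "real \<Rightarrow> real \<Rightarrow> (real \<Rightarrow> 'a::metric_space) \<Rightarrow> bool" where
  "abs_continuous_on a b f \<longleftrightarrow>
     (\<forall>\<epsilon>>0. \<exists>\<delta>>0. \<forall>I. finite I \<and> (\<forall>(u, v)\<in>I. a \<le> u \<and> u \<le> v \<and> v \<le> b) \<and>
        disjoint_family_on (\<lambda>(u, v). {u<..<v}) I \<and> (\<Sum>(u, v)\<in>I. v - u) < \<delta> \<longrightarrow>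
        (\<Sum>(u, v)\<in>I. dist (f u) (f v)) < \<epsilon>)"

text \<open>For a curve of affine maps \<open>g t = (\<lambda>p. A t *v p + r t)\<close> on \<open>[0, \<tau>]\<close>, this is the affine map
  \<open>\<lambda>p. A' t *v p + r' t\<close>.\<close>

definition motion_velocity :: "real \<Rightarrow> (real \<Rightarrow> real^'N \<Rightarrow> real^'N) \<Rightarrow> real \<Rightarrow> real^'N \<Rightarrow> real^'N" where
  "motion_velocity \<tau> g t = (\<lambda>p.
     vector_derivative (\<lambda>s. linear_part (g s)) (at t within {0..\<tau>}) *v p +
     vector_derivative (\<lambda>s. g s 0) (at t within {0..\<tau>}))"

definition tangential_part :: "'a::euclidean_space set \<Rightarrow> 'a \<Rightarrow> 'a" where
  "tangential_part T v = (THE u. u \<in> T \<and> v - u \<in> T\<^sup>\<bottom>)"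

definition normal_part :: "'a::euclidean_space set \<Rightarrow> 'a \<Rightarrow> 'a" where
  "normal_part T v = v - tangential_part T v"

definition covariant_derivative ::
  "'a::euclidean_space set \<Rightarrow> real \<Rightarrow> (real \<Rightarrow> 'a) \<Rightarrow> (real \<Rightarrow> 'a) \<Rightarrow> real \<Rightarrow> 'a" where
  "covariant_derivative M \<tau> c Z t =
     tangential_part (tangent_space M (c t)) (vector_derivative Z (at t within {0..\<tau>}))"

definition normal_covariant_derivative ::
  "'a::euclidean_space set \<Rightarrow> real \<Rightarrow> (real \<Rightarrow> 'a) \<Rightarrow> (real \<Rightarrow> 'a) \<Rightarrow> real \<Rightarrow> 'a" where
  "normal_covariant_derivative M \<tau> c \<Psi> t =
     normal_part (tangent_space M (c t)) (vector_derivative \<Psi> (at t within {0..\<tau>}))"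

definition tangent_field_along ::
  "'a::euclidean_space set \<Rightarrow> real \<Rightarrow> (real \<Rightarrow> 'a) \<Rightarrow> (real \<Rightarrow> 'a) \<Rightarrow> bool" where
  "tangent_field_along M \<tau> c Z \<longleftrightarrow>
     abs_continuous_on 0 \<tau> Z \<and> (\<forall>t\<in>{0..\<tau>}. Z t \<in> tangent_space M (c t))"

definition normal_field_along ::
  "'a::euclidean_space set \<Rightarrow> real \<Rightarrow> (real \<Rightarrow> 'a) \<Rightarrow> (real \<Rightarrow> 'a) \<Rightarrow> bool" where
  "normal_field_along M \<tau> c \<Psi> \<longleftrightarrow>
     abs_continuous_on 0 \<tau> \<Psi> \<and> (\<forall>t\<in>{0..\<tau>}. \<Psi> t \<in> normal_space_at M (c t))"

end

theory Submission
  imports Defs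
begin

text \<open>Absolutely continuous curves are differentiable almost everywhere, so both sets of conditions
  can be compared at a fixed \<open>t\<close>. Write \<open>A\<close> for the linear part of \<open>g\<close>, \<open>b\<close> for its translation part,
  \<open>T\<close> and \<open>T'\<close> for the tangent spaces at \<open>x\<close> and \<open>xh\<close>.
  Differentiating \<open>xh = A x + b\<close> shows that (iii) and (iii') both say \<open>(dA/dt) x + db/dt = 0\<close>. Since \<open>A\<close> is
  orthogonal with \<open>A T = T'\<close>, it intertwines the orthogonal projections, and the derivative of \<open>A Z\<close> is
  \<open>A (dZ/dt) + (dA/dt) Z\<close>; hence (iv') for the field \<open>Z\<close> says that \<open>(dA/dt) Z\<close> is orthogonal to \<open>T'\<close>, whereas (iv)
  says this of \<open>(dA/dt) v\<close> for all \<open>v\<close> in \<open>T\<close>, and likewise for (v). To pass from fields to all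
  vectors outside a single null set, one needs countably many absolutely continuous fields spanning the
  tangent (normal) space at every time: they are the restrictions to the curve of Lipschitz fields on
  \<open>M\<close>, obtained from slice charts by cutting off with bump functions.\<close>

section \<open>Differentiability of absolutely continuous curves\<close>

text \<open>Differentiability is derived from the definition of absolute continuity by Vitali
  coverings. Interior points without a derivative are of two kinds: those with unbounded slopes, and
  those where slopes recur both above and below a rational gap. If such a set had positive measure,
  finite Vitali subfamilies would produce intervals of small total length over which the increments
  of the function are large.

  The difficulty in (iv') and (v') is that the exceptional set depends on the field, and that a
  chart follows the curve only for part of the time. Cutting off in the ambient space gives fields
  defined everywhere; composition with a Lipschitz map preserves absolute continuity, so their
  restrictions to the curve are admissible on all of [0, \<tau>] without subdividing it. Normal
  fields come from adjoints of chart derivatives, which keeps the treatment of the two bundles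
  parallel.\<close>

abbreviation increment :: "(real \<Rightarrow> 'a::ab_group_add) \<Rightarrow> real \<times> real \<Rightarrow> 'a" where
  "increment h i \<equiv> h (snd i) - h (fst i)"

section \<open>Finite families of nonoverlapping intervals\<close>

definition interval_family :: "real \<Rightarrow> real \<Rightarrow> (real \<times> real) set \<Rightarrow> bool" where
  "interval_family a b I \<longleftrightarrow> finite I \<and> (\<forall>(u, v)\<in>I. a \<le> u \<and> u < v \<and> v \<le> b) \<and>
     disjoint_family_on (\<lambda>(u, v). {u<..<v}) I"

lemma open_intervals_disjoint_iff:
  fixes u v u' v' :: real
  assumes "u < v" "u' < v'"
  shows "{u<..<v} \<inter> {u'<..<v'} = {} \<longleftrightarrow> v \<le> u' \<or> v' \<le> u"
proof
  assume "{u<..<v} \<inter> {u'<..<v'} = {}"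
  \<comment> \<open>If the intervals overlap, this is the midpoint of their intersection.\<close>
  then have "(max u u' + min v v') / 2 \<notin> {u<..<v} \<inter> {u'<..<v'}"
    by blast
  then show "v \<le> u' \<or> v' \<le> u"
    using assms by (auto simp: max_def min_def split: if_splits)
qed (use assms in auto)

text \<open>Excluding degenerate intervals makes disjointness an order relation between endpoints,
  with touching allowed; the combinatorial arguments below use this form.\<close>

lemma interval_family_iff:
  "interval_family a b I \<longleftrightarrow> finite I \<and> (\<forall>(u, v)\<in>I. a \<le> u \<and> u < v \<and> v \<le> b) \<and>
     (\<forall>(u, v)\<in>I. \<forall>(u', v')\<in>I. (u, v) \<noteq> (u', v') \<longrightarrow> v \<le> u' \<or> v' \<le> u)"
proof (cases "\<forall>(u, v)\<in>I. a \<le> u \<and> u < v \<and> v \<le> b")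
  case True
  have "disjoint_family_on (\<lambda>(u, v). {u<..<v}) I \<longleftrightarrow>
      (\<forall>i\<in>I. \<forall>j\<in>I. i \<noteq> j \<longrightarrow> snd i \<le> fst j \<or> snd j \<le> fst i)"
    unfolding disjoint_family_on_def
  proof (intro ball_cong refl imp_cong)
    fix i j assume "i \<in> I" "j \<in> I"
    then have "fst i < snd i" "fst j < snd j" using True by auto
    then show "(case i of (u, v) \<Rightarrow> {u<..<v}) \<inter> (case j of (u, v) \<Rightarrow> {u<..<v}) = {} \<longleftrightarrow>
        snd i \<le> fst j \<or> snd j \<le> fst i"
      by (simp only: case_prod_unfold open_intervals_disjoint_iff)
  qed
  then show ?thesis
    unfolding interval_family_def by (simp only: case_prod_unfold prod.collapse)
qed (auto simp: interval_family_def)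

lemma interval_familyD:
  assumes "interval_family a b I"
  shows "finite I" "(u, v) \<in> I \<Longrightarrow> a \<le> u \<and> u < v \<and> v \<le> b"
    "(u, v) \<in> I \<Longrightarrow> (u', v') \<in> I \<Longrightarrow> (u, v) \<noteq> (u', v') \<Longrightarrow> v \<le> u' \<or> v' \<le> u"
  using assms unfolding interval_family_iff by blast+

lemma interval_familyI:
  assumes "finite I" "\<And>u v. (u, v) \<in> I \<Longrightarrow> a \<le> u \<and> u < v \<and> v \<le> b"
    "\<And>u v u' v'. (u, v) \<in> I \<Longrightarrow> (u', v') \<in> I \<Longrightarrow> (u, v) \<noteq> (u', v') \<Longrightarrow> v \<le> u' \<or> v' \<le> u"
  shows "interval_family a b I"
  using assms unfolding interval_family_iff by blast

lemma interval_family_subset: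
  "interval_family a b I \<Longrightarrow> J \<subseteq> I \<Longrightarrow> interval_family a b J"
  unfolding interval_family_iff using finite_subset by blast

lemma abs_continuous_on_familyD:
  assumes "abs_continuous_on a b f" "\<epsilon> > 0"
  obtains \<delta> where "\<delta> > 0" 
    "\<And>I. interval_family a b I \<Longrightarrow> (\<Sum>i\<in>I. increment id i) < \<delta> \<Longrightarrow> (\<Sum>i\<in>I. dist (f (fst i)) (f (snd i))) < \<epsilon>"
proof -
  obtain \<delta> where "\<delta> > 0" and \<delta>: "\<forall>I. finite I \<and> (\<forall>(u, v)\<in>I. a \<le> u \<and> u \<le> v \<and> v \<le> b) \<and>
        disjoint_family_on (\<lambda>(u, v). {u<..<v}) I \<and> (\<Sum>(u, v)\<in>I. v - u) < \<delta> \<longrightarrow>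
        (\<Sum>(u, v)\<in>I. dist (f u) (f v)) < \<epsilon>"
    using assms unfolding abs_continuous_on_def by blast
  show thesis
  proof (rule that[OF \<open>\<delta> > 0\<close>])
    fix I assume "interval_family a b I" "(\<Sum>i\<in>I. increment id i) < \<delta>"
    then have "finite I \<and> (\<forall>(u, v)\<in>I. a \<le> u \<and> u \<le> v \<and> v \<le> b) \<and>
        disjoint_family_on (\<lambda>(u, v). {u<..<v}) I \<and> (\<Sum>(u, v)\<in>I. v - u) < \<delta>"
      unfolding interval_family_def by (auto simp: case_prod_unfold)
    with \<delta> show "(\<Sum>i\<in>I. dist (f (fst i)) (f (snd i))) < \<epsilon>"
      by (metis (mono_tags, lifting) case_prod_unfold sum.cong)
  qed
qed

text \<open>\<open>K\<close> consists of the gaps left by \<open>I\<close>. That both families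
  together tile [a, b] is recorded by telescoping sums, valid for every \<open>h\<close> at once.
  The induction removes the rightmost interval and shrinks \<open>b\<close> to its left
  endpoint.\<close>

lemma interval_family_complement:
  assumes "a \<le> b" "interval_family a b I"
  shows "\<exists>K. I \<inter> K = {} \<and> interval_family a b (I \<union> K) \<and>
    (\<forall>h :: real \<Rightarrow> real. (\<Sum>i\<in>I. increment h i) + (\<Sum>i\<in>K. increment h i) = h b - h a)"
  using assms
proof (induction "card I" arbitrary: b I)
  case 0
  then have "I = {}"
    by (auto simp: interval_family_def)
  show ?case
  proof (cases "a = b")
    case True
    then show ?thesis using \<open>I = {}\<close> by (intro exI[of _ "{}"]) (auto simp: interval_family_iff)
  next
    case False
    then show ?thesis using \<open>I = {}\<close> \<open>a \<le> b\<close>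
      by (intro exI[of _ "{(a,b)}"]) (auto simp: interval_family_iff)
  qed
next
  case (Suc n)
  have fin: "finite I" and ab: "\<And>u v. (u, v) \<in> I \<Longrightarrow> a \<le> u \<and> u < v \<and> v \<le> b"
    and dis: "\<And>u v u' v'. (u, v) \<in> I \<Longrightarrow> (u', v') \<in> I \<Longrightarrow> (u, v) \<noteq> (u', v') \<Longrightarrow> v \<le> u' \<or> v' \<le> u"
    using interval_familyD[OF Suc(4)] by blast+
  have "I \<noteq> {}" using Suc(2) by auto
  have "Max (snd ` I) \<in> snd ` I"
    using fin \<open>I \<noteq> {}\<close> by (intro Max_in) auto
  then obtain u0 v0 where uv0: "(u0, v0) \<in> I" "v0 = Max (snd ` I)"
    by fastforce
  have less: "v \<le> u0" if "(u, v) \<in> I" "(u, v) \<noteq> (u0, v0)" for u v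
  proof -
    have "v \<in> snd ` I" using that by force
    then have "v \<le> v0" using uv0 fin by simp
    then show ?thesis using dis[OF that(1) uv0(1) that(2)] ab[OF that(1)] by linarith
  qed
  define I' where "I' = I - {(u0, v0)}"
  have "n = card I'" using Suc(2) uv0 fin by (simp add: I'_def)
  moreover have "interval_family a u0 I'"
  proof (rule interval_familyI)
    show "a \<le> u \<and> u < v \<and> v \<le> u0" if "(u, v) \<in> I'" for u v
      using that ab[of u v] less[of u v] by (auto simp: I'_def)
  qed (use fin dis in \<open>auto simp: I'_def\<close>)
  ultimately obtain K where K: "I' \<inter> K = {}" "interval_family a u0 (I' \<union> K)"
    "\<And>h :: real \<Rightarrow> real. (\<Sum>i\<in>I'. increment h i) + (\<Sum>i\<in>K. increment h i) = h u0 - h a"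
    using Suc(1)[of I' u0] ab[OF uv0(1)] by auto
  have finK: "finite K" and Kab: "\<And>u v. (u, v) \<in> I' \<union> K \<Longrightarrow> a \<le> u \<and> u < v \<and> v \<le> u0"
    and Kdis: "\<And>u v u' v'. (u, v) \<in> I' \<union> K \<Longrightarrow> (u', v') \<in> I' \<union> K \<Longrightarrow> (u, v) \<noteq> (u', v') \<Longrightarrow> v \<le> u' \<or> v' \<le> u"
    using interval_familyD[OF K(2)] by blast+
  define R where "R = (if v0 < b then {(v0, b)} else {})"
  have R: "(\<Sum>i\<in>R. increment h i) = h b - h v0" for h :: "real \<Rightarrow> real"
    using ab[OF uv0(1)] by (auto simp: R_def not_less)
  have RK: "K \<inter> R = {}" "I \<inter> R = {}" "(u0, v0) \<notin> K"
    using Kab[of v0 b] Kab[of u0 v0] ab[OF uv0(1)] less[of v0 b] ab[of v0 b] by (auto simp: R_def)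
  have I: "I = insert (u0, v0) I'" "(u0, v0) \<notin> I'"
    using uv0 by (auto simp: I'_def)
  have "interval_family a b (I \<union> (K \<union> R))"
  proof (rule interval_familyI)
    show "finite (I \<union> (K \<union> R))"
      using fin finK by (auto simp: R_def)
    have *: "i \<in> I' \<union> K \<or> i = (u0, v0) \<or> i = (v0, b) \<and> v0 < b" if "i \<in> I \<union> (K \<union> R)" for i
      using that by (auto simp: I R_def split: if_splits)
    show "a \<le> u \<and> u < v \<and> v \<le> b" if "(u, v) \<in> I \<union> (K \<union> R)" for u v
      using *[OF that] Kab[of u v] ab[OF uv0(1)] by auto
    show "v \<le> u' \<or> v' \<le> u" if 1: "(u, v) \<in> I \<union> (K \<union> R)" "(u', v') \<in> I \<union> (K \<union> R)" "(u, v) \<noteq> (u', v')"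
      for u v u' v'
      using *[OF 1(1)] *[OF 1(2)] 1(3) Kdis[of u v u' v'] Kab[of u v] Kab[of u' v'] ab[OF uv0(1)]
      by auto
  qed
  moreover have "I \<inter> (K \<union> R) = {}"
    using RK K(1) I by blast
  moreover have "(\<Sum>i\<in>I. increment h i) + (\<Sum>i\<in>K \<union> R. increment h i) = h b - h a" for h :: "real \<Rightarrow> real"
  proof -
    have "(\<Sum>i\<in>K \<union> R. increment h i) = (\<Sum>i\<in>K. increment h i) + (\<Sum>i\<in>R. increment h i)"
      using finK RK by (intro sum.union_disjoint) (auto simp: R_def)
    moreover have "(\<Sum>i\<in>I. increment h i) = (h v0 - h u0) + (\<Sum>i\<in>I'. increment h i)"
      using fin I by simp
    ultimately show ?thesis
      using K(3)[of h] R[of h] by linarith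
  qed
  ultimately show ?case by blast
qed

text \<open>Here \<open>K\<close> is what remains of \<open>I\<close> outside \<open>J\<close>. It
  arises as the complement of \<open>J\<close> joined with the gaps of \<open>I\<close>; comparing
  the two telescoping identities gives the equation. One \<open>K\<close> for all \<open>h\<close>
  lets \<open>h = id\<close> measure its length and \<open>h = f\<close> evaluate the
  increments.\<close>

lemma interval_family_difference:
  assumes "a \<le> b" "interval_family a b I" "interval_family a b J"
    and sub: "\<And>u v. (u, v) \<in> J \<Longrightarrow> \<exists>(u', v')\<in>I. u' \<le> u \<and> v \<le> v'"
  obtains K where "interval_family a b K"
    "\<And>h :: real \<Rightarrow> real. (\<Sum>i\<in>I. increment h i) = (\<Sum>i\<in>J. increment h i) + (\<Sum>i\<in>K. increment h i)"
proof -
  obtain K where K: "I \<inter> K = {}" "interval_family a b (I \<union> K)"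
    "\<And>h :: real \<Rightarrow> real. (\<Sum>i\<in>I. increment h i) + (\<Sum>i\<in>K. increment h i) = h b - h a"
    using interval_family_complement[OF assms(1,2)] by blast
  have IK: "\<And>u v. (u, v) \<in> I \<union> K \<Longrightarrow> a \<le> u \<and> u < v \<and> v \<le> b"
    "\<And>u v u' v'. (u, v) \<in> I \<union> K \<Longrightarrow> (u', v') \<in> I \<union> K \<Longrightarrow> (u, v) \<noteq> (u', v') \<Longrightarrow> v \<le> u' \<or> v' \<le> u"
    using interval_familyD[OF K(2)] by blast+
  have J: "\<And>u v. (u, v) \<in> J \<Longrightarrow> a \<le> u \<and> u < v \<and> v \<le> b"
    "\<And>u v u' v'. (u, v) \<in> J \<Longrightarrow> (u', v') \<in> J \<Longrightarrow> (u, v) \<noteq> (u', v') \<Longrightarrow> v \<le> u' \<or> v' \<le> u"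
    using interval_familyD[OF assms(3)] by blast+
  have fin: "finite J" "finite K"
    using assms(3) K(2) by (auto simp: interval_family_def)
  have JK: "v \<le> u' \<or> v' \<le> u" if uv: "(u, v) \<in> J" and uv': "(u', v') \<in> K" for u v u' v'
  proof -
    obtain p q where "(p, q) \<in> I" "p \<le> u" "v \<le> q"
      using sub[OF uv] by blast
    moreover have "(p, q) \<noteq> (u', v')" using \<open>(p, q) \<in> I\<close> uv' K(1) by blast
    ultimately show ?thesis using IK(2)[of p q u' v'] uv' by auto
  qed
  have "J \<inter> K = {}"
    using JK J(1) by fastforce
  have "interval_family a b (J \<union> K)"
    unfolding interval_family_iff
  proof (intro conjI)
    show "finite (J \<union> K)" using fin by blast
    show "\<forall>(u, v)\<in>J \<union> K. a \<le> u \<and> u < v \<and> v \<le> b" using J(1) IK(1) by blast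
    show "\<forall>(u, v)\<in>J \<union> K. \<forall>(u', v')\<in>J \<union> K. (u, v) \<noteq> (u', v') \<longrightarrow> v \<le> u' \<or> v' \<le> u"
      using J(2) IK(2) JK by blast
  qed
  then obtain L where L: "interval_family a b (J \<union> K \<union> L)"
    "\<And>h :: real \<Rightarrow> real. (\<Sum>i\<in>J \<union> K. increment h i) + (\<Sum>i\<in>L. increment h i) = h b - h a"
    using interval_family_complement[OF assms(1)] by blast
  have "interval_family a b L"
    using L(1) by (rule interval_family_subset) blast
  moreover have "(\<Sum>i\<in>I. increment h i) = (\<Sum>i\<in>J. increment h i) + (\<Sum>i\<in>L. increment h i)" for h :: "real \<Rightarrow> real"
    using L(2)[of h] K(3)[of h] sum.union_disjoint[OF fin \<open>J \<inter> K = {}\<close>, of "increment h"] by simp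
  ultimately show thesis using that by blast
qed

section \<open>Vitali coverings by interval families\<close>

lemma measure_interval_family:
  assumes "interval_family a b I"
  shows "measure lebesgue (\<Union>(u, v)\<in>I. {u<..<v}) = (\<Sum>i\<in>I. increment id i)"
proof -
  have "measure lebesgue (\<Union>(u, v)\<in>I. {u<..<v}) = (\<Sum>i\<in>I. measure lebesgue ((\<lambda>(u, v). {u<..<v}) i))"
    using assms unfolding interval_family_def
    by (intro measure_finite_Union) (auto simp: emeasure_lborel_Ioo)
  also have "\<dots> = (\<Sum>i\<in>I. increment id i)"
    using assms unfolding interval_family_def
    by (intro sum.cong) auto
  finally show ?thesis .
qed

text \<open>On the line a ball is an open interval, so the covering theorem for balls gives
  countably many disjoint admissible intervals that cover \<open>E\<close> up to a null set; by
  continuity of measure from below, finitely many of them miss less than \<open>\<eta>\<close>. The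
  closed intervals are kept inside \<open>G\<close> so that a second family can be nested in a first
  one.\<close>

lemma Vitali_interval_family:
  assumes E: "E \<in> lmeasurable" and G: "open G" "E \<subseteq> G" and "\<eta> > 0"
    and cov: "\<And>x d. x \<in> E \<Longrightarrow> d > 0 \<Longrightarrow> \<exists>u v. P u v \<and> u < x \<and> x < v \<and> v - u < d"
    and P: "\<And>u v. P u v \<Longrightarrow> a \<le> u \<and> v \<le> b"
  obtains I where "interval_family a b I" "\<And>u v. (u, v) \<in> I \<Longrightarrow> P u v \<and> {u..v} \<subseteq> G"
    "measure lebesgue (E \<inter> (\<Union>(u, v)\<in>I. {u<..<v})) > measure lebesgue E - \<eta>"
proof -
  define K where "K = {(u, v). P u v \<and> u < v \<and> {u..v} \<subseteq> G}"
  define c where "c = (\<lambda>(u, v). (u + v) / 2 :: real)"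
  define r where "r = (\<lambda>(u, v). (v - u) / 2 :: real)"
  have ball: "ball (c (u, v)) (r (u, v)) = {u<..<v}" for u v
    by (simp add: c_def r_def ball_eq_greaterThanLessThan field_simps)
  note [simp del] = mem_ball
  have *: "\<exists>i. i \<in> K \<and> x \<in> ball (c i) (r i) \<and> r i < d" if "x \<in> E" "0 < d" for x d
  proof -
    obtain e where e: "e > 0" "cball x e \<subseteq> G"
      using G \<open>x \<in> E\<close> open_contains_cball by blast
    \<comment> \<open>Shorter than \<open>d\<close> for the fineness that the covering theorem asks
      for, shorter than \<open>e\<close> to stay in \<open>G\<close>.\<close>
    obtain u v where uv: "P u v" "u < x" "x < v" "v - u < min d e"
      using cov[OF \<open>x \<in> E\<close>, of "min d e"] e \<open>d > 0\<close> by auto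
    have "{u..v} \<subseteq> cball x e"
      using uv by (auto simp: dist_real_def)
    then have "(u, v) \<in> K"
      using uv e by (auto simp: K_def)
    then show ?thesis
      using uv \<open>d > 0\<close> by (intro exI[of _ "(u, v)"]) (simp add: ball, simp add: r_def)
  qed
  obtain C where C: "countable C" "C \<subseteq> K"
     "pairwise (\<lambda>i j. disjnt (ball (c i) (r i)) (ball (c j) (r j))) C"
     "negligible (E - (\<Union>i \<in> C. ball (c i) (r i)))"
    by (rule Vitali_covering_theorem_balls[of E K c r, OF *]) (assumption | blast)+
  define J where "J n = {i \<in> C. to_nat_on C i < n}" for n
  define A where "A n = E \<inter> (\<Union>(u, v)\<in>J n. {u<..<v})" for n
  have Jf: "interval_family a b (J n)" for n
    unfolding interval_family_def
  proof (intro conjI)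
    have "inj_on (to_nat_on C) (J n)"
      using inj_on_to_nat_on[OF C(1)] by (rule inj_on_subset) (auto simp: J_def)
    moreover have "to_nat_on C ` J n \<subseteq> {..<n}" by (auto simp: J_def)
    ultimately show "finite (J n)" by (meson finite_lessThan inj_on_finite)
    show "\<forall>(u, v)\<in>J n. a \<le> u \<and> u < v \<and> v \<le> b"
      using C(2) P by (auto simp: J_def K_def)
    show "disjoint_family_on (\<lambda>(u, v). {u<..<v}) (J n)"
      unfolding disjoint_family_on_def
    proof (intro ballI impI)
      fix i j assume "i \<in> J n" "j \<in> J n" "i \<noteq> j"
      then have "disjnt (ball (c i) (r i)) (ball (c j) (r j))"
        using C(3) by (auto simp: pairwise_def J_def)
      then show "(case i of (u, v) \<Rightarrow> {u<..<v}) \<inter> (case j of (u, v) \<Rightarrow> {u<..<v}) = {}"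
        by (cases i; cases j) (simp add: ball disjnt_def del: greaterThanLessThan_iff)
    qed
  qed
  have op: "open (\<Union>(u, v)\<in>S. {u<..<v})" for S :: "(real \<times> real) set"
    by (intro open_UN) auto
  have opm: "(\<Union>(u, v)\<in>S. {u<..<v}) \<in> sets lebesgue" for S :: "(real \<times> real) set"
    using borel_open[OF op[of S]] by (intro sets_completionI_sets) simp
  have Em: "E \<in> sets lebesgue"
    using E by (rule fmeasurableD)
  have Am: "A n \<in> sets lebesgue" for n
    unfolding A_def by (rule sets.Int[OF Em opm])
  define B where "B = E \<inter> (\<Union>(u, v)\<in>C. {u<..<v})"
  have B: "B = (\<Union>n. A n)"
  proof
    show "B \<subseteq> (\<Union>n. A n)"
    proof
      fix y assume "y \<in> B"
      then obtain u v where "(u, v) \<in> C" "y \<in> E" "y \<in> {u<..<v}" by (auto simp: B_def)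
      then have "y \<in> A (Suc (to_nat_on C (u, v)))" by (auto simp: A_def J_def)
      then show "y \<in> (\<Union>n. A n)" by blast
    qed
  qed (auto simp: A_def B_def J_def)
  have Bm: "B \<in> lmeasurable"
    unfolding B_def by (rule fmeasurable_Int_fmeasurable[OF E opm])
  have eq: "(\<Union>i \<in> C. ball (c i) (r i)) = (\<Union>(u, v)\<in>C. {u<..<v})"
    by (rule SUP_cong) (auto simp: ball)
  have "negligible ((E - B) \<union> (B - E))"
    by (rule negligible_subset[OF C(4)]) (auto simp: eq B_def)
  then have "measure lebesgue E = measure lebesgue B"
    by (rule measure_negligible_symdiff[OF E, symmetric])
  have "(\<lambda>n. measure lebesgue (A n)) \<longlonglongrightarrow> measure lebesgue B"
    unfolding B
  proof (rule Lim_measure_incseq)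
    show "incseq A" by (auto simp: incseq_def A_def J_def)
    show "emeasure lebesgue (\<Union>n. A n) \<noteq> \<infinity>" using Bm unfolding B[symmetric] fmeasurable_def by (metis (no_types, lifting) infinity_ennreal_def less_irrefl mem_Collect_eq)
  qed (use Am in auto)
  then have "\<forall>\<^sub>F n in sequentially. measure lebesgue (A n) > measure lebesgue B - \<eta>"
    using \<open>\<eta> > 0\<close> by (intro order_tendstoD(1)) auto
  then obtain n where "measure lebesgue (A n) > measure lebesgue E - \<eta>"
    using \<open>measure lebesgue E = _\<close> by (auto simp: eventually_sequentially)
  then show thesis
    using Jf[of n] C(2) by (intro that[of "J n"]) (auto simp: A_def J_def K_def)
qed

section \<open>Elementary properties of absolute continuity\<close>

lemma abs_continuous_onE:
  assumes "abs_continuous_on a b f" "\<epsilon> > 0"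
  obtains \<delta> where "\<delta> > 0" "\<And>I. finite I \<and> (\<forall>(u, v)\<in>I. a \<le> u \<and> u \<le> v \<and> v \<le> b) \<and>
        disjoint_family_on (\<lambda>(u, v). {u<..<v}) I \<and> (\<Sum>(u, v)\<in>I. v - u) < \<delta> \<Longrightarrow>
        (\<Sum>(u, v)\<in>I. dist (f u) (f v)) < \<epsilon>"
  using assms unfolding abs_continuous_on_def by blast

text \<open>All absolute continuity facts below are instances: coordinates and projections of a
  curve, its negative, Lipschitz images, and the subtraction of a linear function, for which the
  term \<open>\<bar>u - v\<bar>\<close> is there.\<close>

lemma abs_continuous_on_dominated:
  assumes f: "abs_continuous_on a b f"
    and dom: "\<And>u v. u \<in> {a..b} \<Longrightarrow> v \<in> {a..b} \<Longrightarrow> dist (h u) (h v) \<le> K * (\<bar>u - v\<bar> + dist (f u) (f v))"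
  shows "abs_continuous_on a b h"
  unfolding abs_continuous_on_def
proof (intro allI impI)
  fix \<epsilon> :: real assume "\<epsilon> > 0"
  \<comment> \<open>\<open>K\<close> may be negative, hence the positive bound \<open>C\<close>.
    Lengths and increments of \<open>f\<close> each receive half of \<epsilon>, so the total length
    has to stay below \<open>e\<close> as well.\<close>
  define C where "C = \<bar>K\<bar> + 1"
  define e where "e = \<epsilon> / (2 * C)"
  have C: "C > 0" "K \<le> C" by (auto simp: C_def)
  have "e > 0" using \<open>\<epsilon> > 0\<close> C by (simp add: e_def)
  obtain d where "d > 0" and d: "\<And>I. finite I \<and> (\<forall>(u, v)\<in>I. a \<le> u \<and> u \<le> v \<and> v \<le> b) \<and>
        disjoint_family_on (\<lambda>(u, v). {u<..<v}) I \<and> (\<Sum>(u, v)\<in>I. v - u) < d \<Longrightarrow>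
        (\<Sum>(u, v)\<in>I. dist (f u) (f v)) < e"
    using abs_continuous_onE[OF f \<open>e > 0\<close>] by blast
  show "\<exists>\<delta>>0. \<forall>I. finite I \<and> (\<forall>(u, v)\<in>I. a \<le> u \<and> u \<le> v \<and> v \<le> b) \<and>
        disjoint_family_on (\<lambda>(u, v). {u<..<v}) I \<and> (\<Sum>(u, v)\<in>I. v - u) < \<delta> \<longrightarrow>
        (\<Sum>(u, v)\<in>I. dist (h u) (h v)) < \<epsilon>"
  proof (intro exI[of _ "min d e"] conjI allI impI)
    fix I assume I: "finite I \<and> (\<forall>(u, v)\<in>I. a \<le> u \<and> u \<le> v \<and> v \<le> b) \<and>
        disjoint_family_on (\<lambda>(u, v). {u<..<v}) I \<and> (\<Sum>(u, v)\<in>I. v - u) < min d e"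
    have "(\<Sum>(u, v)\<in>I. dist (h u) (h v)) \<le> (\<Sum>(u, v)\<in>I. C * ((v - u) + dist (f u) (f v)))"
    proof (rule sum_mono)
      fix i assume "i \<in> I"
      obtain u v where i: "i = (u, v)" by fastforce
      then have uv: "a \<le> u" "u \<le> v" "v \<le> b" using I \<open>i \<in> I\<close> by auto
      have "dist (h u) (h v) \<le> K * (\<bar>u - v\<bar> + dist (f u) (f v))"
        using uv by (intro dom) auto
      also have "\<dots> \<le> C * (\<bar>u - v\<bar> + dist (f u) (f v))"
        using C by (intro mult_right_mono) auto
      finally show "(case i of (u, v) \<Rightarrow> dist (h u) (h v)) \<le>
          (case i of (u, v) \<Rightarrow> C * ((v - u) + dist (f u) (f v)))"
        using uv i by simp
    qed
    also have "\<dots> = C * ((\<Sum>(u, v)\<in>I. v - u) + (\<Sum>(u, v)\<in>I. dist (f u) (f v)))"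
      by (simp only: case_prod_unfold sum.distrib[symmetric] sum_distrib_left)
    also have "\<dots> < C * (e + e)"
      using I d[of I] C by (intro mult_strict_left_mono add_strict_mono) auto
    also have "\<dots> = \<epsilon>"
      using C by (simp add: e_def)
    finally show "(\<Sum>(u, v)\<in>I. dist (h u) (h v)) < \<epsilon>" .
  qed (use \<open>d > 0\<close> \<open>e > 0\<close> in auto)
qed

lemma abs_continuous_on_imp_continuous_on:
  assumes f: "abs_continuous_on a b f"
  shows "continuous_on {a..b} f"
  unfolding continuous_on_iff
proof (intro ballI allI impI)
  fix x e :: real assume x: "x \<in> {a..b}" "e > 0"
  obtain d where "d > 0" and d: "\<And>I. finite I \<and> (\<forall>(u, v)\<in>I. a \<le> u \<and> u \<le> v \<and> v \<le> b) \<and>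
        disjoint_family_on (\<lambda>(u, v). {u<..<v}) I \<and> (\<Sum>(u, v)\<in>I. v - u) < d \<Longrightarrow>
        (\<Sum>(u, v)\<in>I. dist (f u) (f v)) < e"
    using abs_continuous_onE[OF f \<open>e > 0\<close>] by blast
  show "\<exists>d>0. \<forall>y\<in>{a..b}. dist y x < d \<longrightarrow> dist (f y) (f x) < e"
  proof (intro exI[of _ d] conjI ballI impI)
    fix y assume "y \<in> {a..b}" "dist y x < d"
    then show "dist (f y) (f x) < e"
      using d[of "{(min x y, max x y)}"] x
      by (cases "x \<le> y") (auto simp: dist_commute dist_real_def disjoint_family_on_def)
  qed fact
qed

text \<open>The points around which arbitrarily short intervals satisfy \<open>P\<close>. Requiring \<open>x\<close> to be an
  interior point makes this a \<open>G\<^sub>\<delta>\<close> set whatever \<open>P\<close> is; one-sided difference quotients are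
  recovered by continuity.\<close>

definition straddle :: "real \<Rightarrow> real \<Rightarrow> (real \<Rightarrow> real \<Rightarrow> bool) \<Rightarrow> real set" where
  "straddle a b P = {x. \<forall>d>0. \<exists>u v. a \<le> u \<and> u < x \<and> x < v \<and> v \<le> b \<and> v - u < d \<and> P u v}"

lemma straddle_subset: "straddle a b P \<subseteq> {a<..<b}"
  unfolding straddle_def by (auto dest: spec[of _ 1])

lemma straddle_lmeasurable: "straddle a b P \<in> lmeasurable"
proof -
  define U where "U n = (\<Union>(u, v)\<in>{(u, v). a \<le> u \<and> v \<le> b \<and> v - u < inverse (of_nat (Suc n)) \<and> P u v}. {u<..<v})"
    for n
  have "straddle a b P = (\<Inter>n. U n)"
  proof (intro equalityI subsetI)
    fix x assume "x \<in> straddle a b P"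
    show "x \<in> (\<Inter>n. U n)"
    proof (rule INT_I)
      fix n
      have "inverse (real (Suc n)) > 0" by simp
      then obtain u v where "a \<le> u" "u < x" "x < v" "v \<le> b" "v - u < inverse (real (Suc n))" "P u v"
        using \<open>x \<in> straddle a b P\<close> unfolding straddle_def by blast
      then show "x \<in> U n"
        unfolding U_def by (intro UN_I[of "(u, v)"]) auto
    qed
  next
    fix x assume x: "x \<in> (\<Inter>n. U n)"
    show "x \<in> straddle a b P"
      unfolding straddle_def
    proof (clarify)
      fix d :: real assume "d > 0"
      then obtain n where "inverse (of_nat (Suc n)) < d" using reals_Archimedean by blast
      moreover have "x \<in> U n" using x by blast
      then obtain u v where "a \<le> u" "u < x" "x < v" "v \<le> b" "v - u < inverse (real (Suc n))" "P u v"
        unfolding U_def by auto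
      ultimately show "\<exists>u v. a \<le> u \<and> u < x \<and> x < v \<and> v \<le> b \<and> v - u < d \<and> P u v"
        by (meson less_trans)
    qed
  qed
  moreover have "U n \<in> sets borel" for n
    unfolding U_def by (intro borel_open open_UN) auto
  ultimately have "straddle a b P \<in> sets borel"
    by auto
  then have "straddle a b P \<in> sets lebesgue"
    by (intro sets_completionI_sets) simp
  then show ?thesis
    by (rule fmeasurableI2[OF lmeasurable_open straddle_subset, rotated -1]) auto
qed

lemma straddle_scale:
  assumes "x \<in> straddle a b P" "d > 0"
  shows "\<exists>u v. (a \<le> u \<and> v \<le> b \<and> P u v) \<and> u < x \<and> x < v \<and> v - u < d"
  using assms unfolding straddle_def by blast

section \<open>Sets of recurring steep slopes are null\<close>

lemma sum_increment_ge:
  fixes f :: "real \<Rightarrow> real"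
  assumes "\<And>u v. (u, v) \<in> I \<Longrightarrow> f v - f u \<ge> c * (v - u)"
  shows "(\<Sum>i\<in>I. increment f i) \<ge> c * (\<Sum>i\<in>I. increment id i)"
  unfolding sum_distrib_left using assms by (intro sum_mono) auto

text \<open>This is connectedness of the closed interval: if the member around \<open>u\<close>
  ended before \<open>v\<close>, its right endpoint would lie in another member, and the two would
  overlap.\<close>

lemma interval_family_contains:
  assumes I: "interval_family a b I" and "u \<le> v" and sub: "{u..v} \<subseteq> (\<Union>(u, v)\<in>I. {u<..<v})"
  shows "\<exists>(u', v')\<in>I. u' \<le> u \<and> v \<le> v'"
proof -
  obtain u' v' where uv': "(u', v') \<in> I" "u' < u" "u < v'"
    using sub \<open>u \<le> v\<close> by force
  have "v \<le> v'"
  proof (rule ccontr)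
    assume "\<not> v \<le> v'"
    then have "v' \<in> {u..v}" using uv' by auto
    then obtain p q where pq: "(p, q) \<in> I" "p < v'" "v' < q"
      using sub by force
    then show False
      using interval_familyD(3)[OF I pq(1) uv'(1)] uv' by force
  qed
  then show ?thesis using uv' by (intro bexI[OF _ uv'(1)]) auto
qed

lemma lmeasurable_outer_open:
  assumes S: "S \<in> lmeasurable" and "e > 0"
  obtains T where "open T" "S \<subseteq> T" "T \<in> lmeasurable" "measure lebesgue T < measure lebesgue S + e"
proof -
  obtain T where T: "open T" "S \<subseteq> T" "T - S \<in> lmeasurable" "emeasure lebesgue (T - S) < ennreal e"
    using sets_lebesgue_outer_open[OF fmeasurableD[OF S] \<open>e > 0\<close>] .
  have "measure lebesgue (T - S) < e"
    using T(3,4) by (metis emeasure_eq_measure2 ennreal_leI not_less)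
  then have "T \<in> lmeasurable" "measure lebesgue T < measure lebesgue S + e"
    using S T by (auto simp: measurable_measure_Diff dest!: fmeasurable_Diff_D)
  with T(1,2) show thesis by (rule that)
qed

text \<open>Intervals on which \<open>f\<close> increases at rate \<open>c\<close> almost exhaust the set; so do, inside them,
  intervals on which it decreases at rate \<open>c\<close>. The gaps are short, hence the increments of \<open>f\<close> over
  the two families nearly agree, although they have opposite signs.\<close>

lemma negligible_oscillating_slopes:
  fixes f :: "real \<Rightarrow> real"
  assumes f: "abs_continuous_on a b f" and "c > 0"
  shows "negligible (straddle a b (\<lambda>u v. f v - f u > c * (v - u)) \<inter>
                     straddle a b (\<lambda>u v. f v - f u < - c * (v - u)))" (is "negligible (?A \<inter> ?B)")
proof (rule ccontr)
  define E where "E = ?A \<inter> ?B"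
  assume "\<not> negligible (?A \<inter> ?B)"
  have E: "E \<in> lmeasurable"
    unfolding E_def by (intro fmeasurable.Int straddle_lmeasurable)
  define m where "m = measure lebesgue E"
  have "m > 0"
    using \<open>\<not> negligible (?A \<inter> ?B)\<close> E unfolding E_def[symmetric] m_def
    by (simp add: negligible_iff_measure zero_less_measure_iff)
  then have "E \<noteq> {}" by (auto simp: m_def)
  then have "a \<le> b"
    using straddle_subset[of a b] unfolding E_def by fastforce
  obtain \<delta> where "\<delta> > 0" and \<delta>: "\<And>I. interval_family a b I \<Longrightarrow> (\<Sum>i\<in>I. increment id i) < \<delta> \<Longrightarrow>
      (\<Sum>i\<in>I. dist (f (fst i)) (f (snd i))) < c * m / 2"
    using abs_continuous_on_familyD[OF f, of "c * m / 2"] \<open>c > 0\<close> \<open>m > 0\<close> by auto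
  \<comment> \<open>The first family has length below \<open>m + \<eta>\<close> and the second above
    \<open>m - 2 * \<eta>\<close>, so the gaps have length below
    \<open>3 * \<eta> < \<delta>\<close>. The increments of \<open>f\<close> over the two families
    differ by at least \<open>c * (2 * m - 3 * \<eta>)\<close>, which is at least
    \<open>5 / 4 * c * m\<close>, beyond the \<open>c * m / 2\<close> allowed over the gaps.\<close>
  define \<eta> where "\<eta> = min (m / 4) (\<delta> / 4)"
  have \<eta>: "\<eta> > 0" "4 * \<eta> \<le> m" "4 * \<eta> \<le> \<delta>"
    using \<open>m > 0\<close> \<open>\<delta> > 0\<close> by (auto simp: \<eta>_def)
  obtain G where G: "open G" "E \<subseteq> G" "G \<in> lmeasurable" "measure lebesgue G < m + \<eta>"
    using lmeasurable_outer_open[OF E \<open>\<eta> > 0\<close>] unfolding m_def .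
  obtain I where I: "interval_family a b I"
    "\<And>u v. (u, v) \<in> I \<Longrightarrow> (a \<le> u \<and> v \<le> b \<and> f v - f u > c * (v - u)) \<and> {u..v} \<subseteq> G"
    "measure lebesgue (E \<inter> (\<Union>(u, v)\<in>I. {u<..<v})) > measure lebesgue E - \<eta>"
  proof (rule Vitali_interval_family[OF E G(1,2) \<eta>(1)])
    show "\<exists>u v. (a \<le> u \<and> v \<le> b \<and> f v - f u > c * (v - u)) \<and> u < x \<and> x < v \<and> v - u < d"
      if "x \<in> E" "d > 0" for x d
      using straddle_scale[of x a b _ d] that unfolding E_def by blast
  qed auto
  define G1 where "G1 = (\<Union>(u, v)\<in>I. {u<..<v})"
  \<comment> \<open>\<open>E1\<close> is the part of \<open>E\<close> that the first family covers.
    Its points still lie in the second straddling set, so the intervals of decrease can be chosen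
    inside \<open>G1\<close>.\<close>
  define E1 where "E1 = E \<inter> G1"
  have "open G1"
    unfolding G1_def by (intro open_UN) auto
  have "G1 \<subseteq> G"
    using I(2) unfolding G1_def by fastforce
  have G1m: "G1 \<in> sets lebesgue"
    using borel_open[OF \<open>open G1\<close>] by (intro sets_completionI_sets) simp
  have E1: "E1 \<in> lmeasurable"
    unfolding E1_def using E G1m by (rule fmeasurable_Int_fmeasurable)
  obtain J where J: "interval_family a b J"
    "\<And>u v. (u, v) \<in> J \<Longrightarrow> (a \<le> u \<and> v \<le> b \<and> f v - f u < - c * (v - u)) \<and> {u..v} \<subseteq> G1"
    "measure lebesgue (E1 \<inter> (\<Union>(u, v)\<in>J. {u<..<v})) > measure lebesgue E1 - \<eta>"
  proof (rule Vitali_interval_family[OF E1 \<open>open G1\<close> _ \<eta>(1)])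
    show "E1 \<subseteq> G1" by (simp add: E1_def)
    show "\<exists>u v. (a \<le> u \<and> v \<le> b \<and> f v - f u < - c * (v - u)) \<and> u < x \<and> x < v \<and> v - u < d"
      if "x \<in> E1" "d > 0" for x d
      using straddle_scale[of x a b _ d] that unfolding E1_def E_def by blast
  qed auto
  have lenI: "(\<Sum>i\<in>I. increment id i) = measure lebesgue G1"
    unfolding G1_def by (rule measure_interval_family[OF I(1), symmetric])
  have "measure lebesgue G1 \<le> measure lebesgue G"
    by (rule measure_mono_fmeasurable[OF \<open>G1 \<subseteq> G\<close> G1m G(3)])
  moreover have "measure lebesgue E1 \<le> measure lebesgue G1"
    using fmeasurableI2[OF G(3) \<open>G1 \<subseteq> G\<close> G1m] fmeasurableD[OF E1]
    by (intro measure_mono_fmeasurable) (auto simp: E1_def)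
  moreover have "measure lebesgue E1 > m - \<eta>"
    using I(3) unfolding E1_def G1_def m_def .
  moreover
  have "(\<Union>(u, v)\<in>J. {u<..<v}) \<subseteq> G1"
    using J(2) by fastforce
  moreover have Jm: "(\<Union>(u, v)\<in>J. {u<..<v}) \<in> sets lebesgue"
    by (intro sets_completionI_sets) (auto intro!: borel_open open_UN)
  ultimately have "(\<Union>(u, v)\<in>J. {u<..<v}) \<in> lmeasurable"
    using \<open>G1 \<subseteq> G\<close> by (intro fmeasurableI2[OF G(3)]) auto
  then have "measure lebesgue (E1 \<inter> (\<Union>(u, v)\<in>J. {u<..<v})) \<le> (\<Sum>i\<in>J. increment id i)"
    unfolding measure_interval_family[OF J(1), symmetric]
    using fmeasurableD[OF E1] Jm by (intro measure_mono_fmeasurable) auto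
  note bounds = this \<open>measure lebesgue G1 \<le> measure lebesgue G\<close>
    \<open>measure lebesgue E1 \<le> measure lebesgue G1\<close> \<open>measure lebesgue E1 > m - \<eta>\<close> lenI G(4) J(3)
  have "\<exists>(u', v')\<in>I. u' \<le> u \<and> v \<le> v'" if "(u, v) \<in> J" for u v
    using interval_familyD(2)[OF J(1) that] J(2)[OF that] unfolding G1_def
    by (intro interval_family_contains[OF I(1)]) auto
  then obtain K where K: "interval_family a b K"
    "\<And>h :: real \<Rightarrow> real. (\<Sum>i\<in>I. increment h i) = (\<Sum>i\<in>J. increment h i) + (\<Sum>i\<in>K. increment h i)"
    using interval_family_difference[OF \<open>a \<le> b\<close> I(1) J(1)] by blast
  have "(\<Sum>i\<in>K. increment id i) < \<delta>"
    using K(2)[of id] bounds \<eta> by linarith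
  then have "(\<Sum>i\<in>K. dist (f (fst i)) (f (snd i))) < c * m / 2"
    by (rule \<delta>[OF K(1)])
  moreover have "(\<Sum>i\<in>K. increment f i) \<le> (\<Sum>i\<in>K. dist (f (fst i)) (f (snd i)))"
    by (intro sum_mono) (auto simp: dist_real_def)
  moreover have "(\<Sum>i\<in>I. increment f i) \<ge> c * (\<Sum>i\<in>I. increment id i)"
    using I(2) by (intro sum_increment_ge) (auto intro: less_imp_le)
  moreover have "(\<Sum>i\<in>J. increment (\<lambda>x. - f x) i) \<ge> c * (\<Sum>i\<in>J. increment id i)"
    using J(2) by (intro sum_increment_ge) force
  moreover have "(\<Sum>i\<in>J. increment (\<lambda>x. - f x) i) = - (\<Sum>i\<in>J. increment f i)"
    unfolding sum_negf[symmetric] by (intro sum.cong) auto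
  moreover have "c * (\<Sum>i\<in>I. increment id i) \<ge> c * (m - \<eta>)" "c * (\<Sum>i\<in>J. increment id i) \<ge> c * (m - 2 * \<eta>)"
    using bounds \<open>c > 0\<close> by (intro mult_left_mono; simp)+
  ultimately have "c * (m - \<eta>) + c * (m - 2 * \<eta>) < c * m / 2"
    using K(2)[of f] by linarith
  then have "c * (m - \<eta> + (m - 2 * \<eta>)) < c * (m / 2)"
    by (simp add: algebra_simps)
  then show False
    using \<eta> \<open>m > 0\<close> \<open>c > 0\<close> by (simp add: mult_less_cancel_left)
qed

text \<open>If the bad set had measure \<open>m > 0\<close> near \<open>y\<close>, finitely many
  disjoint intervals of slope above \<open>q\<close> would cover more than half of it, and
  \<open>f\<close> would grow by at least \<open>q * m / 2 > 1\<close> over them. Absolute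
  continuity only controls families of length below \<delta>, so the argument is local; local
  negligibility then gives the global claim.\<close>

lemma negligible_infinite_slope:
  fixes f :: "real \<Rightarrow> real"
  assumes f: "abs_continuous_on a b f"
  shows "negligible (\<Inter>q::nat. straddle a b (\<lambda>u v. f v - f u > real q * (v - u)))" (is "negligible ?E")
proof -
  obtain \<delta> where "\<delta> > 0" and \<delta>: "\<And>I. interval_family a b I \<Longrightarrow> (\<Sum>i\<in>I. increment id i) < \<delta> \<Longrightarrow>
      (\<Sum>i\<in>I. dist (f (fst i)) (f (snd i))) < 1"
    using abs_continuous_on_familyD[OF f, of 1] by auto
  \<comment> \<open>A ball of radius \<open>\<delta> / 3\<close> has length
    \<open>2 * \<delta> / 3\<close>, so every interval family inside it is short enough for
    \<delta>.\<close>
  have "negligible (?E \<inter> ball y (\<delta> / 3))" for y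
  proof (rule ccontr)
    define E where "E = ?E \<inter> ball y (\<delta> / 3)"
    assume "\<not> negligible (?E \<inter> ball y (\<delta> / 3))"
    have "?E \<in> sets lebesgue"
      using straddle_lmeasurable by (intro sets.countable_INT') (auto intro: fmeasurableD)
    then have E: "E \<in> lmeasurable"
      unfolding E_def by (subst Int_commute) (intro fmeasurable_Int_fmeasurable lmeasurable_ball)
    define m where "m = measure lebesgue E"
    have "m > 0"
      using \<open>\<not> negligible (?E \<inter> ball y (\<delta> / 3))\<close> E unfolding E_def[symmetric] m_def
      by (simp add: negligible_iff_measure zero_less_measure_iff)
    obtain q :: nat where q: "real q > 2 / m"
      using reals_Archimedean2 by blast
    obtain I where I: "interval_family a b I"
      "\<And>u v. (u, v) \<in> I \<Longrightarrow> (a \<le> u \<and> v \<le> b \<and> f v - f u > real q * (v - u)) \<and> {u..v} \<subseteq> ball y (\<delta> / 3)"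
      "measure lebesgue (E \<inter> (\<Union>(u, v)\<in>I. {u<..<v})) > measure lebesgue E - m / 2"
    proof (rule Vitali_interval_family[OF E open_ball _ half_gt_zero[OF \<open>m > 0\<close>]])
      show "\<exists>u v. (a \<le> u \<and> v \<le> b \<and> f v - f u > real q * (v - u)) \<and> u < x \<and> x < v \<and> v - u < d"
        if "x \<in> E" "d > 0" for x d
        using straddle_scale[of x a b _ d] that unfolding E_def by blast
      show "E \<subseteq> ball y (\<delta> / 3)" by (auto simp: E_def)
    qed auto
    define G where "G = (\<Union>(u, v)\<in>I. {u<..<v})"
    have Gm: "G \<in> sets lebesgue"
      unfolding G_def by (intro sets_completionI_sets) (auto intro!: borel_open open_UN)
    have G: "G \<subseteq> ball y (\<delta> / 3)"
      unfolding G_def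
    proof safe
      fix u v z assume "(u, v) \<in> I" "z \<in> {u<..<v}"
      then show "z \<in> ball y (\<delta> / 3)" using I(2)[of u v] by (meson greaterThanLessThan_subseteq_atLeastAtMost_iff order_refl subsetD)
    qed
    have len: "(\<Sum>i\<in>I. increment id i) = measure lebesgue G"
      unfolding G_def by (rule measure_interval_family[OF I(1), symmetric])
    also have "\<dots> \<le> measure lebesgue (ball y (\<delta> / 3))"
      by (rule measure_mono_fmeasurable[OF G Gm lmeasurable_ball])
    also have "\<dots> < \<delta>"
      using \<open>\<delta> > 0\<close> by (simp add: ball_eq_greaterThanLessThan)
    finally have "(\<Sum>i\<in>I. dist (f (fst i)) (f (snd i))) < 1"
      by (rule \<delta>[OF I(1)])
    moreover have "(\<Sum>i\<in>I. increment f i) \<le> (\<Sum>i\<in>I. dist (f (fst i)) (f (snd i)))"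
      by (intro sum_mono) (auto simp: dist_real_def)
    moreover have "(\<Sum>i\<in>I. increment f i) \<ge> q * (\<Sum>i\<in>I. increment id i)"
      using I(2) by (intro sum_increment_ge) (auto intro: less_imp_le)
    moreover have "measure lebesgue (E \<inter> G) \<le> measure lebesgue G"
      using fmeasurableD[OF E] Gm fmeasurableI2[OF lmeasurable_ball G Gm]
      by (intro measure_mono_fmeasurable) auto
    then have "real q * (m / 2) \<le> real q * (\<Sum>i\<in>I. increment id i)"
      using I(3) len unfolding G_def[symmetric] m_def[symmetric] by (intro mult_left_mono) auto
    ultimately have "real q * (m / 2) < 1" by linarith
    then show False using q \<open>m > 0\<close> by (simp add: field_simps)
  qed
  then have "\<exists>U. openin (top_of_set ?E) U \<and> y \<in> U \<and> negligible U" if "y \<in> ?E" for y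
    using \<open>\<delta> > 0\<close> that by (intro exI[of _ "?E \<inter> ball y (\<delta> / 3)"]) (simp add: openin_open_Int)
  then show ?thesis
    by (subst locally_negligible_alt) blast
qed

text \<open>Subtracting the linear function of slope \<open>k\<close>, the midpoint of
  \<open>p\<close> and \<open>q\<close>, turns the thresholds into \<open>c\<close> and
  \<open>- c\<close>.\<close>

lemma negligible_slope_gap:
  fixes f :: "real \<Rightarrow> real"
  assumes f: "abs_continuous_on a b f" and "p < q"
  shows "negligible (straddle a b (\<lambda>u v. f v - f u > q * (v - u)) \<inter>
                     straddle a b (\<lambda>u v. f v - f u < p * (v - u)))"
proof -
  define k where "k = (p + q) / 2"
  define c where "c = (q - p) / 2"
  define h where "h t = f t - k * t" for t
  have pq: "p = k - c" "q = k + c"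
    by (simp_all add: k_def c_def field_simps)
  have "abs_continuous_on a b h"
  proof (rule abs_continuous_on_dominated[OF f, of _ "\<bar>k\<bar> + 1"])
    fix u v :: real
    have "dist (h u) (h v) \<le> \<bar>f u - f v\<bar> + \<bar>k\<bar> * \<bar>u - v\<bar>"
      unfolding h_def dist_real_def abs_mult[symmetric] by (auto simp: algebra_simps)
    also have "\<dots> \<le> (\<bar>k\<bar> + 1) * (\<bar>u - v\<bar> + dist (f u) (f v))"
      by (simp add: dist_real_def algebra_simps)
    finally show "dist (h u) (h v) \<le> (\<bar>k\<bar> + 1) * (\<bar>u - v\<bar> + dist (f u) (f v))" .
  qed
  moreover have "c > 0" using \<open>p < q\<close> by (simp add: c_def)
  ultimately have "negligible (straddle a b (\<lambda>u v. h v - h u > c * (v - u)) \<inter>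
                     straddle a b (\<lambda>u v. h v - h u < - c * (v - u)))"
    by (rule negligible_oscillating_slopes)
  moreover have "h v - h u > c * (v - u) \<longleftrightarrow> f v - f u > q * (v - u)"
    "h v - h u < - c * (v - u) \<longleftrightarrow> f v - f u < p * (v - u)" for u v
    unfolding h_def pq by (auto simp: algebra_simps)
  ultimately show ?thesis by simp
qed

section \<open>Derivatives from slopes over straddling intervals\<close>

lemma not_straddleD:
  "x \<notin> straddle a b P \<Longrightarrow>
    \<exists>d>0. \<forall>u v. a \<le> u \<and> u < x \<and> x < v \<and> v \<le> b \<and> v - u < d \<longrightarrow> \<not> P u v"
  unfolding straddle_def by blast

text \<open>Hold one endpoint at \<open>y\<close> and let the other tend to \<open>x\<close> from
  the opposite side: by continuity the estimate over straddling intervals becomes the difference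
  quotient estimate at \<open>x\<close>.\<close>

lemma has_derivative_straddling:
  fixes f :: "real \<Rightarrow> real"
  assumes cont: "continuous_on {a..b} f" and x: "a < x" "x < b"
    and D: "\<And>e. e > 0 \<Longrightarrow> \<exists>d>0. \<forall>u v. a \<le> u \<and> u < x \<and> x < v \<and> v \<le> b \<and> v - u < d \<longrightarrow>
        \<bar>f v - f u - D * (v - u)\<bar> \<le> e * (v - u)"
  shows "(f has_derivative (*) D) (at x)"
  unfolding has_derivative_at_alt
proof (intro conjI allI impI)
  show "bounded_linear ((*) D)" by (rule bounded_linear_mult_right)
next
  fix e :: real assume "e > 0"
  then obtain d where "d > 0" and d: "\<forall>u v. a \<le> u \<and> u < x \<and> x < v \<and> v \<le> b \<and> v - u < d \<longrightarrow>
        \<bar>f v - f u - D * (v - u)\<bar> \<le> e * (v - u)"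
    using D[OF \<open>e > 0\<close>] by blast
  have "isCont f x"
    using continuous_on_interior[OF cont] x by simp
  then have lim: "(f \<longlongrightarrow> f x) (at_left x)" "(f \<longlongrightarrow> f x) (at_right x)"
    by (auto simp: isCont_def intro: tendsto_within_subset)
  \<comment> \<open>Both endpoints stay within \<open>r \<le> d / 2\<close> of \<open>x\<close>,
    which makes the interval shorter than \<open>d\<close>; the other bounds keep it inside
    [a, b].\<close>
  define r where "r = min (d / 2) (min (x - a) (b - x))"
  have r: "r > 0" "r \<le> d / 2" "r \<le> x - a" "r \<le> b - x"
    using x \<open>d > 0\<close> by (auto simp: r_def min_def)
  show "\<exists>d>0. \<forall>y. norm (y - x) < d \<longrightarrow> norm (f y - f x - D * (y - x)) \<le> e * norm (y - x)"
  proof (intro exI[of _ r] conjI allI impI)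
    fix y assume y: "norm (y - x) < r"
    consider "y = x" | "x < y" | "y < x" by linarith
    then show "norm (f y - f x - D * (y - x)) \<le> e * norm (y - x)"
    proof cases
      case 2
      have "((\<lambda>u. e * (y - u) - \<bar>f y - f u - D * (y - u)\<bar>) \<longlongrightarrow> e * (y - x) - \<bar>f y - f x - D * (y - x)\<bar>) (at_left x)"
        by (intro tendsto_intros lim)
      moreover have "\<forall>\<^sub>F u in at_left x. 0 \<le> e * (y - u) - \<bar>f y - f u - D * (y - u)\<bar>"
        unfolding eventually_at_left_field
      proof (intro exI[of _ "x - r"] conjI allI impI)
        fix u assume "u > x - r" "u < x"
        then show "0 \<le> e * (y - u) - \<bar>f y - f u - D * (y - u)\<bar>"
          using d[rule_format, of u y] 2 y r by auto
      qed (use r in auto)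
      ultimately have "0 \<le> e * (y - x) - \<bar>f y - f x - D * (y - x)\<bar>"
        by (rule tendsto_lowerbound) simp
      then show ?thesis using 2 by simp
    next
      case 3
      have "((\<lambda>v. e * (v - y) - \<bar>f v - f y - D * (v - y)\<bar>) \<longlongrightarrow> e * (x - y) - \<bar>f x - f y - D * (x - y)\<bar>) (at_right x)"
        by (intro tendsto_intros lim)
      moreover have "\<forall>\<^sub>F v in at_right x. 0 \<le> e * (v - y) - \<bar>f v - f y - D * (v - y)\<bar>"
        unfolding eventually_at_right_field
      proof (intro exI[of _ "x + r"] conjI allI impI)
        fix v assume "v > x" "v < x + r"
        then show "0 \<le> e * (v - y) - \<bar>f v - f y - D * (v - y)\<bar>"
          using d[rule_format, of y v] 3 y r by auto
      qed (use r in auto)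
      ultimately have "0 \<le> e * (x - y) - \<bar>f x - f y - D * (x - y)\<bar>"
        by (rule tendsto_lowerbound) simp
      moreover have "\<bar>f x - f y - D * (x - y)\<bar> = \<bar>f y - f x - D * (y - x)\<bar>"
        by (subst abs_minus_commute) (simp add: algebra_simps)
      ultimately show ?thesis using 3 by simp
    qed simp
  qed (use r in auto)
qed

text \<open>\<open>U\<close> collects the eventual upper bounds of slopes over short straddling
  intervals, so \<open>D = Inf U\<close> is the upper limit of these slopes. The assumptions
  \<open>fin\<close> make it finite, and \<open>osc\<close> forces the lower limit up to it.\<close>

lemma differentiable_at_if_not_straddle:
  fixes f :: "real \<Rightarrow> real"
  assumes cont: "continuous_on {a..b} f" and x: "a < x" "x < b"
    and fin: "x \<notin> straddle a b (\<lambda>u v. f v - f u > q1 * (v - u))"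
      "x \<notin> straddle a b (\<lambda>u v. (- f v) - (- f u) > q2 * (v - u))"
    and osc: "\<And>p q. p \<in> \<rat> \<Longrightarrow> q \<in> \<rat> \<Longrightarrow> p < q \<Longrightarrow> x \<in> straddle a b (\<lambda>u v. f v - f u > q * (v - u)) \<Longrightarrow>
      x \<notin> straddle a b (\<lambda>u v. f v - f u < p * (v - u))"
  shows "f differentiable (at x)"
proof -
  define U where "U = {q. x \<notin> straddle a b (\<lambda>u v. f v - f u > q * (v - u))}"
  have "U \<noteq> {}" using fin by (auto simp: U_def)
  have U: "\<exists>d>0. \<forall>u v. a \<le> u \<and> u < x \<and> x < v \<and> v \<le> b \<and> v - u < d \<longrightarrow> \<not> f v - f u > q * (v - u)"
    if "q \<in> U" for q
    by (rule not_straddleD) (use that in \<open>unfold U_def mem_Collect_eq\<close>)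
  obtain d2 where "d2 > 0" and d2: "\<forall>u v. a \<le> u \<and> u < x \<and> x < v \<and> v \<le> b \<and> v - u < d2 \<longrightarrow>
      \<not> (- f v) - (- f u) > q2 * (v - u)"
    using not_straddleD[OF fin(2)] by (elim exE conjE)
  have lower: "- q2 \<le> q" if "q \<in> U" for q
  proof -
    obtain d where "d > 0" and d: "\<forall>u v. a \<le> u \<and> u < x \<and> x < v \<and> v \<le> b \<and> v - u < d \<longrightarrow>
        \<not> f v - f u > q * (v - u)"
      using U[OF \<open>q \<in> U\<close>] by (elim exE conjE)
    \<comment> \<open>The upper and the lower bound are compared on the symmetric interval of radius
      \<open>r\<close> around \<open>x\<close>; its length \<open>2 * r\<close> is below both
      \<open>d\<close> and \<open>d2\<close>.\<close>
    define r where "r = min (min (d / 3) (d2 / 3)) (min (x - a) (b - x))"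
    have r: "r > 0" "r \<le> d / 3" "r \<le> d2 / 3" "r \<le> x - a" "r \<le> b - x"
      using x \<open>d > 0\<close> \<open>d2 > 0\<close> by (auto simp: r_def min_def)
    have "f (x + r) - f (x - r) \<le> q * (2 * r)" "- f (x + r) + f (x - r) \<le> q2 * (2 * r)"
      using d[rule_format, of "x - r" "x + r"] d2[rule_format, of "x - r" "x + r"] r by auto
    then have "0 \<le> (q + q2) * (2 * r)" by (simp add: algebra_simps)
    then have "0 \<le> q + q2" using \<open>r > 0\<close> by (simp add: zero_le_mult_iff)
    then show ?thesis by simp
  qed
  then have bdd: "bdd_below U" by (auto simp: bdd_below_def)
  define D where "D = Inf U"
  have "(f has_derivative (*) D) (at x)"
  proof (rule has_derivative_straddling[OF cont x])
    fix e :: real assume "e > 0"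
    obtain q where "q \<in> U" "q < D + e"
      using cInf_lessD[OF \<open>U \<noteq> {}\<close>, of "D + e"] \<open>e > 0\<close> unfolding D_def by auto
    obtain d where "d > 0" and d: "\<forall>u v. a \<le> u \<and> u < x \<and> x < v \<and> v \<le> b \<and> v - u < d \<longrightarrow>
        \<not> f v - f u > q * (v - u)"
      using U[OF \<open>q \<in> U\<close>] by (elim exE conjE)
    \<comment> \<open>Two rationals \<open>p < p'\<close> are placed between \<open>D - e\<close>
      and \<open>D\<close>. As \<open>p'\<close> is below the infimum, slopes above
      \<open>p'\<close> recur at every scale, and \<open>osc\<close> then forbids slopes below
      \<open>p\<close> at small scales.\<close>
    obtain p where p: "p \<in> \<rat>" "D - e < p" "p < D"
      using Rats_dense_in_real[of "D - e" D] \<open>e > 0\<close> by auto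
    obtain p' where p': "p' \<in> \<rat>" "p < p'" "p' < D"
      using Rats_dense_in_real[OF p(3)] by auto
    have "p' \<notin> U"
      using cInf_lower[OF _ bdd, of p'] p' unfolding D_def by linarith
    then have "x \<notin> straddle a b (\<lambda>u v. f v - f u < p * (v - u))"
      using osc[OF p(1) p'(1,2)] unfolding U_def by blast
    from not_straddleD[OF this] obtain d' where "d' > 0" and d': "\<forall>u v. a \<le> u \<and> u < x \<and> x < v \<and> v \<le> b \<and> v - u < d' \<longrightarrow>
        \<not> f v - f u < p * (v - u)"
      by (elim exE conjE)
    show "\<exists>d>0. \<forall>u v. a \<le> u \<and> u < x \<and> x < v \<and> v \<le> b \<and> v - u < d \<longrightarrow>
        \<bar>f v - f u - D * (v - u)\<bar> \<le> e * (v - u)"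
    proof (intro exI[of _ "min d d'"] conjI allI impI)
      fix u v assume uv: "a \<le> u \<and> u < x \<and> x < v \<and> v \<le> b \<and> v - u < min d d'"
      have "f v - f u \<le> q * (v - u)" "f v - f u \<ge> p * (v - u)"
        using d[rule_format, of u v] d'[rule_format, of u v] uv by auto
      moreover have "q * (v - u) \<le> (D + e) * (v - u)" "p * (v - u) \<ge> (D - e) * (v - u)"
        using uv \<open>q < D + e\<close> p by (intro mult_right_mono; simp)+
      ultimately have "f v - f u \<le> (D + e) * (v - u)" "f v - f u \<ge> (D - e) * (v - u)"
        by linarith+
      then show "\<bar>f v - f u - D * (v - u)\<bar> \<le> e * (v - u)"
        by (simp add: abs_le_iff algebra_simps)
    qed (use \<open>d > 0\<close> \<open>d' > 0\<close> in auto)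
  qed
  then show ?thesis by (auto simp: differentiable_def)
qed

lemma abs_continuous_on_negligible_not_differentiable:
  fixes f :: "real \<Rightarrow> real"
  assumes f: "abs_continuous_on a b f"
  shows "negligible {x \<in> {a<..<b}. \<not> f differentiable (at x)}"
proof (rule negligible_subset)
  \<comment> \<open>\<open>N1\<close> of \<open>f\<close> and of its negative catches slopes
    unbounded above and below; \<open>N2 p q\<close> catches slopes recurring on both sides of a
    gap. Restriction to rational gaps keeps the union countable.\<close>
  define N1 where "N1 h = (\<Inter>q::nat. straddle a b (\<lambda>u v. h v - h u > real q * (v - u)))" for h :: "real \<Rightarrow> real"
  define N2 where "N2 p q = straddle a b (\<lambda>u v. f v - f u > q * (v - u)) \<inter>
                     straddle a b (\<lambda>u v. f v - f u < p * (v - u))" for p q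
  define Q where "Q = {(p, q). p \<in> \<rat> \<and> q \<in> \<rat> \<and> p < (q::real)}"
  have "countable (\<rat> \<times> \<rat> :: (real \<times> real) set)"
    by (intro countable_SIGMA countable_rat)
  then have "countable Q"
    by (rule countable_subset[rotated]) (auto simp: Q_def)
  have f': "abs_continuous_on a b (\<lambda>x. - f x)"
    by (rule abs_continuous_on_dominated[OF f, of _ 1]) (auto simp: dist_real_def)
  have "negligible (\<Union>((\<lambda>(p, q). N2 p q) ` Q))"
    using \<open>countable Q\<close> negligible_slope_gap[OF f]
    by (intro negligible_countable_Union) (auto simp: N2_def Q_def)
  then show "negligible (N1 f \<union> N1 (\<lambda>x. - f x) \<union> \<Union>((\<lambda>(p, q). N2 p q) ` Q))"
    using negligible_infinite_slope[OF f] negligible_infinite_slope[OF f']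
    unfolding N1_def by (intro negligible_Un)
  show "{x \<in> {a<..<b}. \<not> f differentiable (at x)} \<subseteq> N1 f \<union> N1 (\<lambda>x. - f x) \<union> \<Union>((\<lambda>(p, q). N2 p q) ` Q)"
  proof
    fix x assume x: "x \<in> {x \<in> {a<..<b}. \<not> f differentiable (at x)}"
    show "x \<in> N1 f \<union> N1 (\<lambda>x. - f x) \<union> \<Union>((\<lambda>(p, q). N2 p q) ` Q)"
    proof (rule ccontr)
      assume nx: "x \<notin> N1 f \<union> N1 (\<lambda>x. - f x) \<union> \<Union>((\<lambda>(p, q). N2 p q) ` Q)"
      then obtain q1 q2 :: nat where "x \<notin> straddle a b (\<lambda>u v. f v - f u > real q1 * (v - u))"
        "x \<notin> straddle a b (\<lambda>u v. (- f v) - (- f u) > real q2 * (v - u))"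
        unfolding N1_def by blast
      moreover have "x \<notin> N2 p q" if "p \<in> \<rat>" "q \<in> \<rat>" "p < q" for p q
        using nx that by (auto simp: Q_def)
      then have "x \<notin> straddle a b (\<lambda>u v. f v - f u < p * (v - u))"
        if "p \<in> \<rat>" "q \<in> \<rat>" "p < q" "x \<in> straddle a b (\<lambda>u v. f v - f u > q * (v - u))" for p q
        using that unfolding N2_def by blast
      ultimately have "f differentiable (at x)"
        using x by (intro differentiable_at_if_not_straddle[OF abs_continuous_on_imp_continuous_on[OF f]]) auto
      then show False using x by blast
    qed
  qed
qed

text \<open>The endpoints join the null set, and the conclusion records that \<open>t\<close> is
  interior, because there derivatives within the closed interval are ordinary two-sided
  ones.\<close>

theorem abs_continuous_on_AE_differentiable:
  fixes f :: "real \<Rightarrow> 'a::euclidean_space"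
  assumes f: "abs_continuous_on a b f"
  shows "AE t in lebesgue_on {a..b}. t \<in> {a<..<b} \<and> f differentiable (at t)"
proof -
  define N where "N = {a, b} \<union> (\<Union>i\<in>Basis. {x \<in> {a<..<b}. \<not> (\<lambda>t. f t \<bullet> i) differentiable (at x)})"
  have "abs_continuous_on a b (\<lambda>t. f t \<bullet> i)" if "i \<in> Basis" for i
  proof (rule abs_continuous_on_dominated[OF f, of _ 1])
    show "dist (f u \<bullet> i) (f v \<bullet> i) \<le> 1 * (\<bar>u - v\<bar> + dist (f u) (f v))" for u v
      using Basis_le_norm[OF that, of "f u - f v"] by (simp add: dist_norm inner_diff_left)
  qed
  then have "negligible (\<Union>i\<in>Basis. {x \<in> {a<..<b}. \<not> (\<lambda>t. f t \<bullet> i) differentiable (at x)})"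
    using abs_continuous_on_negligible_not_differentiable
    by (intro negligible_Union) (auto simp del: greaterThanLessThan_iff)
  then have "negligible N"
    unfolding N_def by (intro negligible_Un) auto
  then have "AE t in lebesgue. t \<notin> N"
    by (auto simp: negligible_iff_null_sets intro: AE_not_in)
  then have "AE t in lebesgue. t \<in> {a..b} \<longrightarrow> t \<in> {a<..<b} \<and> f differentiable (at t)"
  proof (rule AE_mp, intro AE_I2 impI)
    fix t assume t: "t \<notin> N" "t \<in> {a..b}"
    then have "t \<in> {a<..<b}" by (auto simp: N_def)
    moreover have "(\<lambda>t. f t \<bullet> i) differentiable (at t)" if "i \<in> Basis" for i
      using t \<open>t \<in> {a<..<b}\<close> that unfolding N_def by blast
    then have "f differentiable (at t)"
      by (subst differentiable_componentwise_within) blast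
    ultimately show "t \<in> {a<..<b} \<and> f differentiable (at t)" by blast
  qed
  then show ?thesis
    by (subst AE_restrict_space_iff) auto
qed

section \<open>Lipschitz frames of the tangent and normal spaces\<close>

lemma smooth_on_differentiable: "smooth_on S f \<Longrightarrow> p \<in> S \<Longrightarrow> f differentiable (at p)"
  unfolding smooth_on_def by (auto dest: spec[of _ "Suc 0"])

lemma smooth_on_frechet_derivative:
  "smooth_on S f \<Longrightarrow> smooth_on S (\<lambda>p. frechet_derivative f (at p) v)"
  unfolding smooth_on_def by (metis Ck_on.simps(2))

lemma smooth_on_continuous_on: "smooth_on S f \<Longrightarrow> continuous_on S f"
  unfolding smooth_on_def by (auto dest: spec[of _ 0])

lemma smooth_on_has_derivative:
  "smooth_on S f \<Longrightarrow> p \<in> S \<Longrightarrow> (f has_derivative frechet_derivative f (at p)) (at p)"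
  using smooth_on_differentiable frechet_derivative_works by blast

definition lipschitz_near :: "'a::metric_space \<Rightarrow> ('a \<Rightarrow> 'b::metric_space) \<Rightarrow> bool" where
  "lipschitz_near p f \<longleftrightarrow> (\<exists>r>0. \<exists>C. C-lipschitz_on (cball p r) f)"

text \<open>\<open>c1_implies_local_lipschitz\<close> speaks of time-dependent fields, hence the
  dummy \<open>t\<close>. It asks for a derivative that is continuous as an operator; in finite
  dimension this follows from continuity of each directional derivative, which is what
  \<open>smooth_on\<close> supplies.\<close>

lemma smooth_on_lipschitz_near:
  fixes f :: "'a::euclidean_space \<Rightarrow> 'a"
  assumes "open S" "smooth_on S f" "p \<in> S"
  shows "lipschitz_near p f"
proof -
  define f' where "f' = (\<lambda>(t :: real, x). Blinfun (frechet_derivative f (at x)))"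
  have f': "blinfun_apply (f' (t, x)) = frechet_derivative f (at x)" if "x \<in> S" for t x
    unfolding f'_def using smooth_on_has_derivative[OF assms(2) that]
    by (simp add: bounded_linear_Blinfun_apply has_derivative_bounded_linear)
  have "local_lipschitz (UNIV :: real set) S (\<lambda>_. f)"
  proof (rule c1_implies_local_lipschitz[where f' = f'])
    show "(f has_derivative blinfun_apply (f' (t, x))) (at x)" if "x \<in> S" for t x
      using smooth_on_has_derivative[OF assms(2) that] f'[OF that] by simp
    show "continuous_on (UNIV \<times> S) f'"
    proof (rule continuous_on_blinfun_componentwise)
      fix i :: 'a
      have "continuous_on S (\<lambda>x. frechet_derivative f (at x) i)"
        by (intro smooth_on_continuous_on smooth_on_frechet_derivative assms)
      then have "continuous_on (UNIV \<times> S) (\<lambda>z::real \<times> 'a. frechet_derivative f (at (snd z)) i)"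
        by (rule continuous_on_compose2) (auto intro: continuous_intros)
      then show "continuous_on (UNIV \<times> S) (\<lambda>z. blinfun_apply (f' z) i)"
        by (rule continuous_on_eq) (auto simp: f')
    qed
  qed (use assms in auto)
  then have "\<exists>u>0. \<exists>L. \<forall>t\<in>cball (0::real) u \<inter> UNIV. L-lipschitz_on (cball p u \<inter> S) f"
    unfolding local_lipschitz_def using \<open>p \<in> S\<close> by (blast dest: bspec[where x = "0::real"])
  then obtain u L where "u > 0" and L: "\<forall>t\<in>cball (0::real) u \<inter> UNIV. L-lipschitz_on (cball p u \<inter> S) f"
    by (elim exE conjE)
  have Lf: "L-lipschitz_on (cball p u \<inter> S) f"
    using bspec[OF L, of 0] \<open>u > 0\<close> by simp
  obtain e where "e > 0" "cball p e \<subseteq> S"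
    using assms(1)[unfolded open_contains_cball] assms(3) by blast
  then have "L-lipschitz_on (cball p (min u e)) f"
    by (intro lipschitz_on_subset[OF Lf]) auto
  then show ?thesis
    unfolding lipschitz_near_def using \<open>u > 0\<close> \<open>e > 0\<close> by (intro exI[of _ "min u e"]) auto
qed

lemma lipschitz_near_compose:
  assumes f: "lipschitz_near p f" and g: "lipschitz_near (f p) g"
  shows "lipschitz_near p (\<lambda>x. g (f x))"
proof -
  obtain r C where rC: "r > 0" "C-lipschitz_on (cball p r) f"
    using f by (auto simp: lipschitz_near_def)
  obtain s D where sD: "s > 0" "D-lipschitz_on (cball (f p) s) g"
    using g by (auto simp: lipschitz_near_def)
  have "C \<ge> 0" using rC(2) by (rule lipschitz_on_nonneg)
  \<comment> \<open>This radius keeps the image of the ball where \<open>g\<close> is Lipschitz;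
    adding 1 to \<open>C\<close> avoids division by zero.\<close>
  define e where "e = min r (s / (C + 1))"
  have "e > 0" using rC sD \<open>C \<ge> 0\<close> by (simp add: e_def)
  have "f ` cball p e \<subseteq> cball (f p) s"
  proof safe
    fix x assume x: "x \<in> cball p e"
    then have "dist (f p) (f x) \<le> C * dist p x"
      using rC by (intro lipschitz_onD[OF rC(2)]) (auto simp: e_def)
    also have "\<dots> \<le> (C + 1) * (s / (C + 1))"
      using x \<open>C \<ge> 0\<close> by (intro mult_mono) (auto simp: e_def)
    also have "\<dots> = s" using \<open>C \<ge> 0\<close> by simp
    finally show "f x \<in> cball (f p) s" by simp
  qed
  moreover have "C-lipschitz_on (cball p e) f"
    by (rule lipschitz_on_subset[OF rC(2)]) (auto simp: e_def)
  ultimately have "(D * C)-lipschitz_on (cball p e) (\<lambda>x. g (f x))"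
    using lipschitz_on_compose2[OF _ lipschitz_on_subset[OF sD(2)]] by blast
  then show ?thesis
    unfolding lipschitz_near_def using \<open>e > 0\<close> by blast
qed

lemma lipschitz_near_linear:
  fixes f :: "'a::metric_space \<Rightarrow> 'b::euclidean_space" and h :: "'b \<Rightarrow> 'c::real_normed_vector"
  assumes f: "lipschitz_near p f" and h: "linear h"
  shows "lipschitz_near p (\<lambda>x. h (f x))"
proof (rule lipschitz_near_compose[OF f])
  obtain B where B: "\<And>x. norm (h x) \<le> B * norm x" "B > 0"
    using linear_bounded_pos[OF h] by blast
  have "B-lipschitz_on (cball (f p) 1) h"
    using B by (intro lipschitz_onI) (auto simp: dist_norm linear_diff[OF h, symmetric])
  then show "lipschitz_near (f p) h"
    unfolding lipschitz_near_def by (intro exI[of _ 1]) auto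
qed

lemma lipschitz_near_sum:
  fixes f :: "'i \<Rightarrow> 'a::metric_space \<Rightarrow> 'b::real_normed_vector"
  assumes "finite I" "\<And>i. i \<in> I \<Longrightarrow> lipschitz_near p (f i)"
  shows "lipschitz_near p (\<lambda>x. \<Sum>i\<in>I. f i x)"
  using assms
proof (induction I)
  case empty
  have "0-lipschitz_on (cball p 1) (\<lambda>x. 0 :: 'b)" by (rule lipschitz_on_constant)
  then show ?case unfolding lipschitz_near_def by (intro exI[of _ 1]) auto
next
  case (insert i I)
  obtain r C where rC: "r > 0" "C-lipschitz_on (cball p r) (f i)"
    using insert.prems[of i] unfolding lipschitz_near_def by blast
  obtain s D where sD: "s > 0" "D-lipschitz_on (cball p s) (\<lambda>x. \<Sum>i\<in>I. f i x)"
    using insert.IH insert.prems unfolding lipschitz_near_def by blast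
  have "(C + D)-lipschitz_on (cball p (min r s)) (\<lambda>x. f i x + (\<Sum>i\<in>I. f i x))"
    by (intro lipschitz_on_add lipschitz_on_subset[OF rC(2)] lipschitz_on_subset[OF sD(2)]) auto
  then show ?case
    using insert(1,2) rC(1) sD(1) unfolding lipschitz_near_def
    by (intro exI[of _ "min r s"]) auto
qed

text \<open>The cutoff is 1-Lipschitz, bounded by \<open>r\<close>, and positive exactly on the open
  ball, while \<open>f\<close> is bounded by \<open>B\<close> on the closed ball; the product rule
  gives the constant \<open>r * C + B\<close>. Outside the ball nothing is known of
  \<open>f\<close>, but there the product vanishes, and the cutoff at the other point is at most the
  distance.\<close>

lemma lipschitz_bump:
  fixes f :: "'a::metric_space \<Rightarrow> 'b::real_normed_vector"
  assumes f: "C-lipschitz_on (cball p r) f" and "r > 0"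
  shows "\<exists>D. D-lipschitz_on UNIV (\<lambda>q. max 0 (r - dist p q) *\<^sub>R f q)"
proof -
  define \<eta> where "\<eta> q = max 0 (r - dist p q)" for q
  define B where "B = norm (f p) + C * r"
  have "C \<ge> 0" using f by (rule lipschitz_on_nonneg)
  have "B \<ge> 0" using \<open>C \<ge> 0\<close> \<open>r > 0\<close> by (simp add: B_def)
  have \<eta>: "0 \<le> \<eta> q" "\<eta> q \<le> r" "\<bar>\<eta> u - \<eta> v\<bar> \<le> dist u v" for q u v
    using dist_triangle[of p u v] dist_triangle[of p v u] \<open>r > 0\<close>
    by (auto simp: \<eta>_def dist_commute)
  have fB: "norm (f q) \<le> B" if "q \<in> cball p r" for q
  proof -
    have "norm (f q) \<le> norm (f p) + norm (f q - f p)"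
      using norm_triangle_ineq[of "f p" "f q - f p"] by simp
    also have "norm (f q - f p) \<le> C * dist q p"
      using lipschitz_onD[OF f, of q p] that \<open>r > 0\<close> by (simp add: dist_norm)
    also have "\<dots> \<le> C * r"
      using that \<open>C \<ge> 0\<close> by (intro mult_left_mono) (auto simp: dist_commute)
    finally show ?thesis by (simp add: B_def)
  qed
  have half: "dist (\<eta> u *\<^sub>R f u) (\<eta> v *\<^sub>R f v) \<le> (r * C + B) * dist u v" if "u \<in> cball p r" for u v
  proof (cases "v \<in> cball p r")
    case True
    have "\<eta> u *\<^sub>R f u - \<eta> v *\<^sub>R f v = \<eta> v *\<^sub>R (f u - f v) + (\<eta> u - \<eta> v) *\<^sub>R f u"
      by (simp add: algebra_simps)
    then have "dist (\<eta> u *\<^sub>R f u) (\<eta> v *\<^sub>R f v) \<le> \<eta> v * norm (f u - f v) + \<bar>\<eta> u - \<eta> v\<bar> * norm (f u)"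
      unfolding dist_norm
      using norm_triangle_ineq[of "\<eta> v *\<^sub>R (f u - f v)" "(\<eta> u - \<eta> v) *\<^sub>R f u"] \<eta>(1)[of v] by simp
    also have "\<dots> \<le> r * (C * dist u v) + dist u v * B"
      using \<eta> fB[OF that] lipschitz_onD[OF f that True] \<open>r > 0\<close> \<open>B \<ge> 0\<close>
      by (intro add_mono mult_mono) (auto simp: dist_norm)
    finally show ?thesis by (simp add: algebra_simps)
  next
    case False
    then have "\<eta> v = 0" by (simp add: \<eta>_def)
    then have "dist (\<eta> u *\<^sub>R f u) (\<eta> v *\<^sub>R f v) = \<bar>\<eta> u - \<eta> v\<bar> * norm (f u)"
      by simp
    also have "\<dots> \<le> dist u v * B"
      using \<eta> fB[OF that] by (intro mult_mono) auto
    also have "\<dots> \<le> (r * C + B) * dist u v"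
      using \<open>r > 0\<close> \<open>C \<ge> 0\<close> by (simp add: algebra_simps)
    finally show ?thesis .
  qed
  have "(r * C + B)-lipschitz_on UNIV (\<lambda>q. \<eta> q *\<^sub>R f q)"
  proof (rule lipschitz_onI)
    fix u v
    consider "u \<in> cball p r" | "v \<in> cball p r" | "u \<notin> cball p r" "v \<notin> cball p r" by blast
    then show "dist (\<eta> u *\<^sub>R f u) (\<eta> v *\<^sub>R f v) \<le> (r * C + B) * dist u v"
    proof cases
      case 2
      then show ?thesis using half[of v u] by (simp add: dist_commute)
    next
      case 3
      then have "\<eta> u = 0" "\<eta> v = 0" by (auto simp: \<eta>_def)
      then show ?thesis using \<open>r > 0\<close> \<open>C \<ge> 0\<close> \<open>B \<ge> 0\<close> by simp
    qed (rule half)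
  qed (use \<open>r > 0\<close> \<open>C \<ge> 0\<close> \<open>B \<ge> 0\<close> in simp)
  then show ?thesis unfolding \<eta>_def by blast
qed

section \<open>Countable spanning families of global Lipschitz sections\<close>

definition lipschitz_section :: "'a::euclidean_space set \<Rightarrow> ('a \<Rightarrow> 'a set) \<Rightarrow> ('a \<Rightarrow> 'a) \<Rightarrow> bool" where
  "lipschitz_section M S E \<longleftrightarrow> (\<exists>C. C-lipschitz_on UNIV E) \<and> (\<forall>q\<in>M. E q \<in> S q)"

text \<open>Cutting off makes the frame global: outside \<open>U\<close> the fields are 0, which
  lies in every subspace \<open>S q\<close>, and on the open ball they are positive multiples of the
  frame, so their span is the same.\<close>

lemma lipschitz_section_frame:
  fixes M :: "'a::euclidean_space set" and F :: "'i \<Rightarrow> 'a \<Rightarrow> 'a"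
  assumes S: "\<And>q. q \<in> M \<Longrightarrow> subspace (S q)"
    and U: "open U" "p \<in> U" and B: "finite B" "\<And>b. b \<in> B \<Longrightarrow> lipschitz_near p (F b)"
    and span: "\<And>q. q \<in> M \<inter> U \<Longrightarrow> S q = span ((\<lambda>b. F b q) ` B)"
  shows "\<exists>r>0. \<exists>\<E>. finite \<E> \<and> (\<forall>E\<in>\<E>. lipschitz_section M S E) \<and>
    (\<forall>q\<in>M \<inter> ball p r. S q \<subseteq> span ((\<lambda>E. E q) ` \<E>))"
proof -
  obtain R where R: "R > 0" "cball p R \<subseteq> U"
    using U(1)[unfolded open_contains_cball] U(2) by blast
  have "\<forall>b\<in>B. \<exists>r. r > 0 \<and> (\<exists>C. C-lipschitz_on (cball p r) (F b))"
    using B(2) by (auto simp: lipschitz_near_def)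
  then obtain \<rho> where \<rho>: "\<And>b. b \<in> B \<Longrightarrow> \<rho> b > 0" "\<And>b. b \<in> B \<Longrightarrow> \<exists>C. C-lipschitz_on (cball p (\<rho> b)) (F b)"
    by metis
  define r where "r = Min (insert R (\<rho> ` B))"
  have r: "r > 0" "r \<le> R" "\<And>b. b \<in> B \<Longrightarrow> r \<le> \<rho> b"
    using R \<rho>(1) B(1) by (auto simp: r_def)
  define \<eta> where "\<eta> q = max 0 (r - dist p q)" for q
  define \<E> where "\<E> = (\<lambda>b q. \<eta> q *\<^sub>R F b q) ` B"
  have "lipschitz_section M S E" if "E \<in> \<E>" for E
  proof -
    obtain b where b: "b \<in> B" "E = (\<lambda>q. \<eta> q *\<^sub>R F b q)"
      using \<open>E \<in> \<E>\<close> by (auto simp: \<E>_def)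
    obtain C where "C-lipschitz_on (cball p (\<rho> b)) (F b)"
      using \<rho>(2) b(1) by blast
    then have "C-lipschitz_on (cball p r) (F b)"
      by (rule lipschitz_on_subset) (use r(3)[OF b(1)] in auto)
    then have "\<exists>D. D-lipschitz_on UNIV E"
      unfolding b(2) \<eta>_def using r(1) by (rule lipschitz_bump)
    moreover have "E q \<in> S q" if "q \<in> M" for q
    proof (cases "q \<in> U")
      case True
      then have "F b q \<in> S q"
        using span that b(1) by (auto intro: span_base)
      then show ?thesis using S[OF that] by (simp add: b(2) subspace_scale)
    next
      case False
      then have "q \<notin> cball p r" using R r(2) by force
      then have "\<eta> q = 0" by (simp add: \<eta>_def)
      then show ?thesis using S[OF that] by (simp add: b(2) subspace_0)
    qed
    ultimately show ?thesis by (simp add: lipschitz_section_def)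
  qed
  moreover have "S q \<subseteq> span ((\<lambda>E. E q) ` \<E>)" if q: "q \<in> M \<inter> ball p r" for q
  proof -
    have "q \<in> U" using q R r(2) by force
    have "\<eta> q > 0" using q by (simp add: \<eta>_def)
    have "F b q \<in> span ((\<lambda>E. E q) ` \<E>)" if "b \<in> B" for b
    proof -
      have "\<eta> q *\<^sub>R F b q \<in> (\<lambda>E. E q) ` \<E>"
        using that by (auto simp: \<E>_def)
      then have "(1 / \<eta> q) *\<^sub>R \<eta> q *\<^sub>R F b q \<in> span ((\<lambda>E. E q) ` \<E>)"
        by (intro span_scale span_base)
      then show ?thesis using \<open>\<eta> q > 0\<close> by simp
    qed
    then have "span ((\<lambda>b. F b q) ` B) \<subseteq> span ((\<lambda>E. E q) ` \<E>)"
      by (intro span_minimal) auto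
    then show ?thesis using span q \<open>q \<in> U\<close> by simp
  qed
  moreover have "finite \<E>" using B(1) by (simp add: \<E>_def)
  ultimately show ?thesis using r(1) by blast
qed

text \<open>By the Lindelof property countably many of the balls cover \<open>M\<close>, and the
  union of their finite families works: fields belonging to other balls are sections over all of
  \<open>M\<close> too, and adding them only enlarges the span.\<close>

lemma lipschitz_section_countable:
  fixes M :: "'a::euclidean_space set"
  assumes "\<And>p. p \<in> M \<Longrightarrow> \<exists>r>0. \<exists>\<E>. finite \<E> \<and> (\<forall>E\<in>\<E>. lipschitz_section M S E) \<and>
    (\<forall>q\<in>M \<inter> ball p r. S q \<subseteq> span ((\<lambda>E. E q) ` \<E>))"
  shows "\<exists>\<E>. countable \<E> \<and> (\<forall>E\<in>\<E>. lipschitz_section M S E) \<and>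
    (\<forall>q\<in>M. S q \<subseteq> span ((\<lambda>E. E q) ` \<E>))"
proof -
  have "\<forall>p\<in>M. \<exists>r. r > 0 \<and> (\<exists>\<E>. finite \<E> \<and> (\<forall>E\<in>\<E>. lipschitz_section M S E) \<and>
    (\<forall>q\<in>M \<inter> ball p r. S q \<subseteq> span ((\<lambda>E. E q) ` \<E>)))"
    using assms by blast
  then obtain r where r: "\<forall>p\<in>M. r p > 0 \<and> (\<exists>\<E>. finite \<E> \<and> (\<forall>E\<in>\<E>. lipschitz_section M S E) \<and>
    (\<forall>q\<in>M \<inter> ball p (r p). S q \<subseteq> span ((\<lambda>E. E q) ` \<E>)))"
    by (rule bchoice[THEN exE])
  then have "\<forall>p\<in>M. \<exists>\<E>. finite \<E> \<and> (\<forall>E\<in>\<E>. lipschitz_section M S E) \<and>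
    (\<forall>q\<in>M \<inter> ball p (r p). S q \<subseteq> span ((\<lambda>E. E q) ` \<E>))"
    by blast
  then obtain e where e: "\<forall>p\<in>M. finite (e p) \<and> (\<forall>E\<in>e p. lipschitz_section M S E) \<and>
    (\<forall>q\<in>M \<inter> ball p (r p). S q \<subseteq> span ((\<lambda>E. E q) ` e p))"
    by (rule bchoice[THEN exE])
  obtain \<F> where \<F>: "\<F> \<subseteq> (\<lambda>p. ball p (r p)) ` M" "countable \<F>" "\<Union>\<F> = \<Union>((\<lambda>p. ball p (r p)) ` M)"
    by (rule Lindelof[of "(\<lambda>p. ball p (r p)) ` M"]) auto
  obtain P where P: "countable P" "P \<subseteq> M" "\<F> = (\<lambda>p. ball p (r p)) ` P"
    using countable_subset_image[THEN iffD1, OF conjI[OF \<F>(2,1)]] by (elim exE conjE)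
  show ?thesis
  proof (intro exI[of _ "\<Union>(e ` P)"] conjI ballI)
    show "countable (\<Union>(e ` P))"
      using P(1,2) e by (intro countable_UN) (auto intro: countable_finite)
    show "lipschitz_section M S E" if "E \<in> \<Union>(e ` P)" for E
      using that P(2) e by blast
    show "S q \<subseteq> span ((\<lambda>E. E q) ` \<Union>(e ` P))" if "q \<in> M" for q
    proof -
      have "q \<in> \<Union>((\<lambda>p. ball p (r p)) ` M)" using r that by force
      then obtain p where p: "p \<in> P" "q \<in> ball p (r p)" using \<F>(3) P(3) by blast
      then have "S q \<subseteq> span ((\<lambda>E. E q) ` e p)"
        using e that P(2) by blast
      also have "\<dots> \<subseteq> span ((\<lambda>E. E q) ` \<Union>(e ` P))"
        using p(1) by (intro span_mono) auto
      finally show ?thesis .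
    qed
  qed
qed

section \<open>Tangent and normal spaces in slice charts\<close>

definition slice_chart ::
  "'a::euclidean_space set \<Rightarrow> 'a set \<Rightarrow> 'a set \<Rightarrow> ('a \<Rightarrow> 'a) \<Rightarrow> ('a \<Rightarrow> 'a) \<Rightarrow> 'a set \<Rightarrow> bool" where
  "slice_chart M U V \<phi> \<psi> L \<longleftrightarrow> open U \<and> open V \<and> homeomorphism U V \<phi> \<psi> \<and> smooth_on U \<phi> \<and>
     smooth_on V \<psi> \<and> subspace L \<and> \<phi> ` (M \<inter> U) = L \<inter> V"

lemma slice_chartD:
  assumes "slice_chart M U V \<phi> \<psi> L"
  shows "open U" "open V" "smooth_on U \<phi>" "smooth_on V \<psi>" "subspace L"
    "x \<in> U \<Longrightarrow> \<phi> x \<in> V" "x \<in> U \<Longrightarrow> \<psi> (\<phi> x) = x"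
    "x \<in> M \<Longrightarrow> x \<in> U \<Longrightarrow> \<phi> x \<in> L" "y \<in> L \<Longrightarrow> y \<in> V \<Longrightarrow> \<psi> y \<in> M"
proof -
  note c = assms[unfolded slice_chart_def homeomorphism_def]
  show "open U" "open V" "smooth_on U \<phi>" "smooth_on V \<psi>" "subspace L"
    using c by auto
  show V: "x \<in> U \<Longrightarrow> \<phi> x \<in> V" and inv: "x \<in> U \<Longrightarrow> \<psi> (\<phi> x) = x" for x
    using c by auto
  have im: "\<phi> ` (M \<inter> U) = L \<inter> V" using c by simp
  show "\<phi> x \<in> L" if "x \<in> M" "x \<in> U"
    using im that by blast
  show "\<psi> y \<in> M" if "y \<in> L" "y \<in> V"
  proof -
    have "y \<in> \<phi> ` (M \<inter> U)" using im that by blast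
    then obtain x where "x \<in> M" "x \<in> U" "y = \<phi> x" by blast
    then show ?thesis using inv by simp
  qed
qed

lemma embedded_submanifold_slice_chart:
  assumes "embedded_submanifold n M" "p \<in> M"
  obtains U V \<phi> \<psi> L where "p \<in> U" "slice_chart M U V \<phi> \<psi> L"
  using bspec[OF assms(1)[unfolded embedded_submanifold_def] assms(2)] unfolding slice_chart_def
  by (elim exE conjE) blast

lemma slice_chart_derivative_inverse:
  assumes c: "slice_chart M U V \<phi> \<psi> L" and q: "q \<in> U"
  shows "frechet_derivative \<psi> (at (\<phi> q)) (frechet_derivative \<phi> (at q) v) = v"
proof -
  note chart = slice_chartD[OF c]
  have "(\<psi> \<circ> \<phi> has_derivative frechet_derivative \<psi> (at (\<phi> q)) \<circ> frechet_derivative \<phi> (at q)) (at q)"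
    by (intro diff_chain_at smooth_on_has_derivative[OF chart(3) q]
        smooth_on_has_derivative[OF chart(4) chart(6)[OF q]])
  then have "((\<lambda>x. x) has_derivative frechet_derivative \<psi> (at (\<phi> q)) \<circ> frechet_derivative \<phi> (at q)) (at q)"
    by (rule has_derivative_transform_within_open[OF _ chart(1) q]) (simp add: chart(7))
  then have "frechet_derivative \<psi> (at (\<phi> q)) \<circ> frechet_derivative \<phi> (at q) = (\<lambda>x. x)"
    by (rule has_derivative_unique) (rule has_derivative_ident)
  then show ?thesis by (metis comp_apply)
qed

text \<open>A curve in \<open>M\<close> read in the chart runs in \<open>L\<close>, and so does its
  velocity; conversely, straight lines in \<open>L\<close> pull back to curves in \<open>M\<close>.
  The second claim is kept separately because the description of the normal space uses it
  too.\<close>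

lemma tangent_space_slice_chart:
  assumes c: "slice_chart M U V \<phi> \<psi> L" and q: "q \<in> M" "q \<in> U"
  shows "tangent_space M q = frechet_derivative \<psi> (at (\<phi> q)) ` L"
    and "v \<in> tangent_space M q \<Longrightarrow> frechet_derivative \<phi> (at q) v \<in> L"
proof -
  note chart = slice_chartD[OF c]
  have d\<phi>: "(\<phi> has_derivative frechet_derivative \<phi> (at q)) (at q)"
    by (rule smooth_on_has_derivative[OF chart(3) q(2)])
  have d\<psi>: "(\<psi> has_derivative frechet_derivative \<psi> (at y)) (at y)" if "y \<in> V" for y
    by (rule smooth_on_has_derivative[OF chart(4) that])
  show in_L: "frechet_derivative \<phi> (at q) v \<in> L" if v: "v \<in> tangent_space M q" for v
  proof -
    obtain \<gamma> \<epsilon> where \<gamma>: "\<epsilon> > 0" "\<gamma> differentiable_on {-\<epsilon><..<\<epsilon>}" "\<gamma> ` {-\<epsilon><..<\<epsilon>} \<subseteq> M"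
        "\<gamma> 0 = q" "(\<gamma> has_vector_derivative v) (at 0)"
      using v unfolding tangent_space_def by blast
    have "continuous_on {-\<epsilon><..<\<epsilon>} \<gamma>"
      by (rule differentiable_imp_continuous_on[OF \<gamma>(2)])
    \<comment> \<open>\<open>\<gamma>\<close> may leave \<open>U\<close>, but by continuity not at
      times near 0, where the derivative is taken.\<close>
    then have op: "open ({-\<epsilon><..<\<epsilon>} \<inter> \<gamma> -` U)"
      by (rule continuous_open_preimage) (auto simp: chart(1))
    have mem: "0 \<in> {-\<epsilon><..<\<epsilon>} \<inter> \<gamma> -` U"
      using \<gamma>(1,4) q(2) by simp
    have comp: "(\<phi> \<circ> \<gamma> has_vector_derivative frechet_derivative \<phi> (at q) v) (at 0)"
      using vector_derivative_diff_chain_within[OF \<gamma>(5), of \<phi>] d\<phi> \<gamma>(4) has_derivative_at_withinI by metis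
    \<comment> \<open>Membership in \<open>L\<close> is tested against its normals:
      \<open>(\<phi> \<circ> \<gamma>) s \<bullet> w\<close> vanishes for \<open>s\<close> near 0,
      hence so does its derivative, and
      \<open>L\<^sup>\<bottom>\<^sup>\<bottom> = L\<close>.\<close>
    have "frechet_derivative \<phi> (at q) v \<bullet> w = 0" if w: "w \<in> L\<^sup>\<bottom>" for w
    proof -
      have "((\<lambda>s. (\<phi> \<circ> \<gamma>) s \<bullet> w) has_vector_derivative frechet_derivative \<phi> (at q) v \<bullet> w) (at 0)"
        by (rule bounded_linear.has_vector_derivative[OF bounded_linear_inner_left comp])
      then have "((\<lambda>s. 0 :: real) has_vector_derivative frechet_derivative \<phi> (at q) v \<bullet> w) (at 0)"
      proof (rule has_vector_derivative_transform_within_open[OF _ op mem])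
        fix s assume "s \<in> {-\<epsilon><..<\<epsilon>} \<inter> \<gamma> -` U"
        then have "\<phi> (\<gamma> s) \<in> L" using \<gamma>(3) chart(8)[of "\<gamma> s"] by blast
        then show "(\<phi> \<circ> \<gamma>) s \<bullet> w = 0"
          using w by (auto simp: orthogonal_comp_def orthogonal_def)
      qed
      then show ?thesis
        using vector_derivative_unique_at[OF _ has_vector_derivative_const] by blast
    qed
    then have "frechet_derivative \<phi> (at q) v \<in> L\<^sup>\<bottom>\<^sup>\<bottom>"
      by (auto simp: orthogonal_comp_def[of "L\<^sup>\<bottom>"] orthogonal_def inner_commute)
    then show ?thesis using orthogonal_comp_self[OF chart(5)] by simp
  qed
  show "tangent_space M q = frechet_derivative \<psi> (at (\<phi> q)) ` L"
  proof
    show "tangent_space M q \<subseteq> frechet_derivative \<psi> (at (\<phi> q)) ` L"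
    proof
      fix v assume "v \<in> tangent_space M q"
      then have "frechet_derivative \<phi> (at q) v \<in> L" by (rule in_L)
      then show "v \<in> frechet_derivative \<psi> (at (\<phi> q)) ` L"
        using slice_chart_derivative_inverse[OF c q(2), of v] by (metis imageI)
    qed
    show "frechet_derivative \<psi> (at (\<phi> q)) ` L \<subseteq> tangent_space M q"
    proof safe
      fix l assume l: "l \<in> L"
      define \<beta> where "\<beta> s = \<phi> q + s *\<^sub>R l" for s :: real
      have d\<beta>: "(\<beta> has_vector_derivative l) (at s)" for s
        unfolding \<beta>_def by (auto intro!: derivative_eq_intros)
      have "open (\<beta> -` V)"
        unfolding \<beta>_def by (intro open_vimage chart(2) continuous_intros)
      moreover have "0 \<in> \<beta> -` V"
        using chart(6)[OF q(2)] by (simp add: \<beta>_def)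
      ultimately obtain \<epsilon> where \<epsilon>: "\<epsilon> > 0" "ball 0 \<epsilon> \<subseteq> \<beta> -` V"
        using open_contains_ball by blast
      have V: "\<beta> s \<in> V" if "s \<in> {-\<epsilon><..<\<epsilon>}" for s
        using subsetD[OF \<epsilon>(2), of s] that by (auto simp: dist_real_def abs_less_iff)
      have chain: "(\<psi> \<circ> \<beta> has_vector_derivative frechet_derivative \<psi> (at (\<beta> s)) l) (at s)" if "s \<in> {-\<epsilon><..<\<epsilon>}" for s
        by (rule vector_derivative_diff_chain_within[OF d\<beta>])
          (rule has_derivative_at_withinI[OF d\<psi>[OF V[OF that]]])
      have "\<psi> \<circ> \<beta> differentiable_on {-\<epsilon><..<\<epsilon>}"
        unfolding differentiable_on_def
      proof
        fix s assume "s \<in> {-\<epsilon><..<\<epsilon>}"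
        then show "\<psi> \<circ> \<beta> differentiable at s within {-\<epsilon><..<\<epsilon>}"
          by (rule differentiable_at_withinI[OF differentiableI_vector[OF chain]])
      qed
      moreover have "(\<psi> \<circ> \<beta>) ` {-\<epsilon><..<\<epsilon>} \<subseteq> M"
      proof safe
        fix s assume "s \<in> {-\<epsilon><..<\<epsilon>}"
        moreover have "\<beta> s \<in> L"
          unfolding \<beta>_def using chart(5) chart(8)[OF q] l by (intro subspace_add subspace_scale)
        ultimately show "(\<psi> \<circ> \<beta>) s \<in> M" using V chart(9) by simp
      qed
      moreover have "(\<psi> \<circ> \<beta>) 0 = q"
        using chart(7)[OF q(2)] by (simp add: \<beta>_def)
      moreover have "(\<psi> \<circ> \<beta> has_vector_derivative frechet_derivative \<psi> (at (\<phi> q)) l) (at 0)"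
        using chain[of 0] \<epsilon>(1) by (simp add: \<beta>_def)
      ultimately show "frechet_derivative \<psi> (at (\<phi> q)) l \<in> tangent_space M q"
        unfolding tangent_space_def using \<epsilon>(1) by blast
    qed
  qed
qed

lemma slice_chart_linear:
  assumes c: "slice_chart M U V \<phi> \<psi> L" and q: "q \<in> U"
  shows "linear (frechet_derivative \<psi> (at (\<phi> q)))" "linear (frechet_derivative \<phi> (at q))"
proof -
  note chart = slice_chartD[OF c]
  show "linear (frechet_derivative \<psi> (at (\<phi> q)))"
    by (rule has_derivative_linear[OF smooth_on_has_derivative[OF chart(4) chart(6)[OF q]]])
  show "linear (frechet_derivative \<phi> (at q))"
    by (rule has_derivative_linear[OF smooth_on_has_derivative[OF chart(3) q]])
qed

lemma subspace_tangent_space: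
  assumes "embedded_submanifold n M" "q \<in> M"
  shows "subspace (tangent_space M q)"
proof -
  obtain U V \<phi> \<psi> L where c: "q \<in> U" "slice_chart M U V \<phi> \<psi> L"
    using embedded_submanifold_slice_chart[OF assms] .
  show ?thesis
    unfolding tangent_space_slice_chart(1)[OF c(2) assms(2) c(1)]
    by (rule linear_subspace_image[OF slice_chart_linear(1)[OF c(2,1)] slice_chartD(5)[OF c(2)]])
qed

text \<open>Near \<open>q\<close>, \<open>M\<close> is the common zero set of the functions
  \<open>\<phi> x \<bullet> w\<close> with \<open>w\<close> in \<open>L\<^sup>\<bottom>\<close>, and
  the adjoint sends \<open>w\<close> to the gradient of such a function. The gradients exhaust the
  normal space: the adjoint of \<open>?d\<phi>\<close> after that of \<open>?d\<psi>\<close> is the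
  adjoint of \<open>?d\<psi> \<circ> ?d\<phi>\<close>, the identity.\<close>

lemma normal_space_slice_chart:
  assumes c: "slice_chart M U V \<phi> \<psi> L" and q: "q \<in> M" "q \<in> U"
  shows "normal_space_at M q = adjoint (frechet_derivative \<phi> (at q)) ` (L\<^sup>\<bottom>)"
proof
  let ?d\<phi> = "frechet_derivative \<phi> (at q)" and ?d\<psi> = "frechet_derivative \<psi> (at (\<phi> q))"
  note lin = slice_chart_linear[OF c q(2)]
  note T = tangent_space_slice_chart[OF c q]
  show "adjoint ?d\<phi> ` (L\<^sup>\<bottom>) \<subseteq> normal_space_at M q"
  proof safe
    fix w assume w: "w \<in> L\<^sup>\<bottom>"
    have "v \<bullet> adjoint ?d\<phi> w = 0" if "v \<in> tangent_space M q" for v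
      using w T(2)[OF that] by (simp add: adjoint_works[OF lin(2)] orthogonal_comp_def orthogonal_def)
    then show "adjoint ?d\<phi> w \<in> normal_space_at M q"
      by (simp add: orthogonal_comp_def orthogonal_def)
  qed
  show "normal_space_at M q \<subseteq> adjoint ?d\<phi> ` (L\<^sup>\<bottom>)"
  proof
    fix u assume u: "u \<in> normal_space_at M q"
    have "l \<bullet> adjoint ?d\<psi> u = 0" if "l \<in> L" for l
      using u that by (simp add: adjoint_works[OF lin(1)] orthogonal_comp_def orthogonal_def T(1))
    then have "adjoint ?d\<psi> u \<in> L\<^sup>\<bottom>"
      by (simp add: orthogonal_comp_def orthogonal_def)
    moreover have "adjoint ?d\<phi> (adjoint ?d\<psi> u) = u"
    proof (rule vector_eq_ldot[THEN iffD1], rule allI)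
      show "v \<bullet> adjoint ?d\<phi> (adjoint ?d\<psi> u) = v \<bullet> u" for v
        by (simp add: adjoint_works[OF lin(1)] adjoint_works[OF lin(2)]
            slice_chart_derivative_inverse[OF c q(2)])
    qed
    ultimately show "u \<in> adjoint ?d\<phi> ` (L\<^sup>\<bottom>)" by (metis imageI)
  qed
qed

lemma finite_spanning_set:
  fixes S :: "'a::euclidean_space set"
  assumes "subspace S"
  obtains B where "finite B" "span B = S"
proof -
  obtain B where "B \<subseteq> S" "independent B" "S \<subseteq> span B" "card B = dim S"
    using basis_exists by blast
  then show thesis
    using span_minimal[OF \<open>B \<subseteq> S\<close> assms] by (intro that[of B] independent_imp_finite) auto
qed

text \<open>Near \<open>p\<close> the frame consists of the vectors
  \<open>frechet_derivative \<psi> (at (\<phi> q)) l\<close>, with \<open>l\<close> in a finite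
  spanning set of \<open>L\<close>; as a composite of smooth maps it is Lipschitz in
  \<open>q\<close> near \<open>p\<close>.\<close>

lemma tangent_lipschitz_sections:
  assumes M: "embedded_submanifold n M"
  shows "\<exists>\<E>. countable \<E> \<and> (\<forall>E\<in>\<E>. lipschitz_section M (tangent_space M) E) \<and>
    (\<forall>q\<in>M. tangent_space M q \<subseteq> span ((\<lambda>E. E q) ` \<E>))"
proof (rule lipschitz_section_countable[of M "tangent_space M"])
  fix p assume p: "p \<in> M"
  obtain U V \<phi> \<psi> L where c: "p \<in> U" "slice_chart M U V \<phi> \<psi> L"
    using embedded_submanifold_slice_chart[OF M p] .
  note chart = slice_chartD[OF c(2)]
  obtain B where B: "finite B" "span B = L"
    using finite_spanning_set[OF chart(5)] .
  show "\<exists>r>0. \<exists>\<E>. finite \<E> \<and> (\<forall>E\<in>\<E>. lipschitz_section M (tangent_space M) E) \<and>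
    (\<forall>q\<in>M \<inter> ball p r. tangent_space M q \<subseteq> span ((\<lambda>E. E q) ` \<E>))"
  proof (rule lipschitz_section_frame[OF subspace_tangent_space[OF M] chart(1) c(1) B(1)])
    fix l
    have "lipschitz_near p \<phi>"
      by (rule smooth_on_lipschitz_near[OF chart(1,3) c(1)])
    moreover have "lipschitz_near (\<phi> p) (\<lambda>y. frechet_derivative \<psi> (at y) l)"
      by (rule smooth_on_lipschitz_near[OF chart(2) smooth_on_frechet_derivative[OF chart(4)] chart(6)[OF c(1)]])
    ultimately show "lipschitz_near p (\<lambda>q. frechet_derivative \<psi> (at (\<phi> q)) l)"
      by (rule lipschitz_near_compose)
  next
    fix q assume "q \<in> M \<inter> U"
    then have q: "q \<in> M" "q \<in> U" by auto
    show "tangent_space M q = span ((\<lambda>l. frechet_derivative \<psi> (at (\<phi> q)) l) ` B)"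
      unfolding tangent_space_slice_chart(1)[OF c(2) q] B(2)[symmetric]
      by (rule linear_span_image[OF slice_chart_linear(1)[OF c(2) q(2)], symmetric])
  qed
qed

lemma normal_lipschitz_sections:
  assumes M: "embedded_submanifold n M"
  shows "\<exists>\<E>. countable \<E> \<and> (\<forall>E\<in>\<E>. lipschitz_section M (normal_space_at M) E) \<and>
    (\<forall>q\<in>M. normal_space_at M q \<subseteq> span ((\<lambda>E. E q) ` \<E>))"
proof (rule lipschitz_section_countable[of M "normal_space_at M"])
  fix p assume p: "p \<in> M"
  obtain U V \<phi> \<psi> L where c: "p \<in> U" "slice_chart M U V \<phi> \<psi> L"
    using embedded_submanifold_slice_chart[OF M p] .
  note chart = slice_chartD[OF c(2)]
  obtain B where B: "finite B" "span B = L\<^sup>\<bottom>"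
    using finite_spanning_set[OF subspace_orthogonal_comp] .
  show "\<exists>r>0. \<exists>\<E>. finite \<E> \<and> (\<forall>E\<in>\<E>. lipschitz_section M (normal_space_at M) E) \<and>
    (\<forall>q\<in>M \<inter> ball p r. normal_space_at M q \<subseteq> span ((\<lambda>E. E q) ` \<E>))"
  proof (rule lipschitz_section_frame[OF subspace_orthogonal_comp chart(1) c(1) B(1)])
    fix w
    \<comment> \<open>This is the adjoint of the derivative of \<phi> at \<open>q\<close>, applied
      to \<open>w\<close>, in coordinates. The expansion shows the dependence on \<open>q\<close>
      through directional derivatives only.\<close>
    have "lipschitz_near p (\<lambda>q. \<Sum>b\<in>Basis. (frechet_derivative \<phi> (at q) b \<bullet> w) *\<^sub>R b)"
    proof (rule lipschitz_near_sum[OF finite_Basis])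
      fix b :: 'a
      have "lipschitz_near p (\<lambda>q. frechet_derivative \<phi> (at q) b)"
        by (rule smooth_on_lipschitz_near[OF chart(1) smooth_on_frechet_derivative[OF chart(3)] c(1)])
      moreover have "linear (\<lambda>y. (y \<bullet> w) *\<^sub>R b)"
        by (rule linearI) (simp_all add: inner_add_left scaleR_add_left)
      ultimately show "lipschitz_near p (\<lambda>q. (frechet_derivative \<phi> (at q) b \<bullet> w) *\<^sub>R b)"
        by (rule lipschitz_near_linear)
    qed
    then show "lipschitz_near p (\<lambda>q. \<Sum>b\<in>Basis. (frechet_derivative \<phi> (at q) b \<bullet> w) *\<^sub>R b)" .
  next
    fix q assume "q \<in> M \<inter> U"
    then have q: "q \<in> M" "q \<in> U" by auto
    note lin = slice_chart_linear(2)[OF c(2) q(2)]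
    have "adjoint (frechet_derivative \<phi> (at q)) w = (\<Sum>b\<in>Basis. (frechet_derivative \<phi> (at q) b \<bullet> w) *\<^sub>R b)" for w
      using euclidean_representation[of "adjoint (frechet_derivative \<phi> (at q)) w"]
      by (simp add: inner_commute[of "adjoint _ _"] adjoint_works[OF lin])
    then have eq: "(\<lambda>w. \<Sum>b\<in>Basis. (frechet_derivative \<phi> (at q) b \<bullet> w) *\<^sub>R b) = adjoint (frechet_derivative \<phi> (at q))"
      by (simp add: fun_eq_iff)
    show "normal_space_at M q = span ((\<lambda>w. \<Sum>b\<in>Basis. (frechet_derivative \<phi> (at q) b \<bullet> w) *\<^sub>R b) ` B)"
      unfolding normal_space_slice_chart[OF c(2) q] B(2)[symmetric] eq
      by (rule linear_span_image[OF adjoint_linear[OF lin], symmetric])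
  qed
qed

section \<open>Rigid motions and covariant derivatives\<close>

lemma tangential_part_unique:
  assumes T: "subspace T" and u: "u \<in> T" "v - u \<in> T\<^sup>\<bottom>"
  shows "tangential_part T v = u"
  unfolding tangential_part_def
proof (rule the_equality)
  fix w assume w: "w \<in> T \<and> v - w \<in> T\<^sup>\<bottom>"
  have "u - w \<in> T"
    using T u(1) w by (intro subspace_diff) auto
  moreover have "(v - w) - (v - u) \<in> T\<^sup>\<bottom>"
    using subspace_diff[OF subspace_orthogonal_comp _ u(2)] w by blast
  ultimately have "(u - w) \<bullet> ((v - w) - (v - u)) = 0"
    unfolding orthogonal_comp_def orthogonal_def by blast
  then show "w = u" by simp
qed (use u in blast)

lemma tangential_part:
  assumes T: "subspace T"
  shows "tangential_part T v \<in> T" "v - tangential_part T v \<in> T\<^sup>\<bottom>"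
proof -
  obtain u w where uw: "v = u + w" "u \<in> T" "w \<in> T\<^sup>\<bottom>"
    using subspace_sum_orthogonal_comp[OF T] set_plus_elim by blast
  then have "tangential_part T v = u"
    by (intro tangential_part_unique[OF T]) simp_all
  then show "tangential_part T v \<in> T" "v - tangential_part T v \<in> T\<^sup>\<bottom>"
    using uw by simp_all
qed

lemma tangential_part_add:
  assumes T: "subspace T"
  shows "tangential_part T (u + v) = tangential_part T u + tangential_part T v"
proof (rule tangential_part_unique[OF T])
  show "tangential_part T u + tangential_part T v \<in> T"
    using tangential_part(1)[OF T] T by (intro subspace_add)
  have "(u - tangential_part T u) + (v - tangential_part T v) \<in> T\<^sup>\<bottom>"
    by (intro subspace_add[OF subspace_orthogonal_comp] tangential_part(2)[OF T])
  then show "u + v - (tangential_part T u + tangential_part T v) \<in> T\<^sup>\<bottom>"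
    by (simp add: algebra_simps)
qed

lemma tangential_part_eq_0_iff:
  assumes T: "subspace T"
  shows "tangential_part T v = 0 \<longleftrightarrow> v \<in> T\<^sup>\<bottom>"
  using tangential_part(2)[OF T, of v] tangential_part_unique[OF T subspace_0[OF T], of v] by auto

lemma tangential_part_eq_self_iff:
  assumes T: "subspace T"
  shows "tangential_part T v = v \<longleftrightarrow> v \<in> T"
  using tangential_part(1)[OF T, of v] tangential_part_unique[OF T, of v v]
    subspace_0[OF subspace_orthogonal_comp] by auto

lemma orthogonal_comp_orthogonal_image:
  fixes f :: "'a::euclidean_space \<Rightarrow> 'a"
  assumes f: "orthogonal_transformation f"
  shows "(f ` S)\<^sup>\<bottom> = f ` (S\<^sup>\<bottom>)"
proof -
  have "f u \<in> (f ` S)\<^sup>\<bottom> \<longleftrightarrow> u \<in> S\<^sup>\<bottom>" for u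
    using f by (simp add: orthogonal_comp_def orthogonal_def orthogonal_transformation_def)
  then show ?thesis
    using orthogonal_transformation_surj[OF f] by (metis (no_types, lifting) image_subsetI subset_antisym subsetI surjD imageI)
qed

lemma tangential_part_orthogonal_image:
  fixes f :: "'a::euclidean_space \<Rightarrow> 'a"
  assumes f: "orthogonal_transformation f" and T: "subspace T"
  shows "tangential_part (f ` T) (f v) = f (tangential_part T v)"
proof (rule tangential_part_unique)
  note lin = orthogonal_transformation_linear[OF f]
  show "subspace (f ` T)" by (rule linear_subspace_image[OF lin T])
  show "f (tangential_part T v) \<in> f ` T" using tangential_part(1)[OF T] by blast
  show "f v - f (tangential_part T v) \<in> (f ` T)\<^sup>\<bottom>"
    unfolding linear_diff[OF lin, symmetric] orthogonal_comp_orthogonal_image[OF f]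
    using tangential_part(2)[OF T] by blast
qed

section \<open>Derivatives and tangent spaces under rigid motions\<close>

lemma bounded_bilinear_matrix_vector_mult:
  "bounded_bilinear ((*v) :: real^'n^'m \<Rightarrow> real^'n \<Rightarrow> real^'m)"
  unfolding bilinear_conv_bounded_bilinear[symmetric] bilinear_def
  by (auto intro!: linearI simp: matrix_vector_mult_add_rdistrib matrix_vector_right_distrib
      scaleR_matrix_vector_assoc[symmetric] matrix_vector_mult_scaleR)

lemma has_vector_derivative_matrix_vector_mult:
  fixes A :: "real \<Rightarrow> real^'n^'m"
  assumes "(A has_vector_derivative A') (at t)" "(z has_vector_derivative z') (at t)"
  shows "((\<lambda>s. A s *v z s) has_vector_derivative (A t *v z' + A' *v z t)) (at t)"
  by (rule bounded_bilinear.has_vector_derivative[OF bounded_bilinear_matrix_vector_mult assms])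

text \<open>As an inclusion for an arbitrary matrix it applies to a rigid motion and to its inverse,
  which together give equality.\<close>

lemma tangent_space_affine_image_subset:
  fixes A :: "real^'n^'n"
  assumes v: "v \<in> tangent_space M p"
  shows "A *v v \<in> tangent_space ((\<lambda>p. A *v p + r) ` M) (A *v p + r)"
proof -
  obtain \<gamma> \<epsilon> where \<gamma>: "\<epsilon> > 0" "\<gamma> differentiable_on {-\<epsilon><..<\<epsilon>}" "\<gamma> ` {-\<epsilon><..<\<epsilon>} \<subseteq> M"
      "\<gamma> 0 = p" "(\<gamma> has_vector_derivative v) (at 0)"
    using v unfolding tangent_space_def by blast
  define h where "h p = A *v p + r" for p
  have dh: "(h has_derivative (*v) A) (at q)" for q
    unfolding h_def by (rule has_derivative_affine)
  have "h \<circ> \<gamma> differentiable_on {-\<epsilon><..<\<epsilon>}"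
    unfolding differentiable_on_def
  proof
    fix s assume "s \<in> {-\<epsilon><..<\<epsilon>}"
    then have "\<gamma> differentiable at s within {-\<epsilon><..<\<epsilon>}"
      using \<gamma>(2) by (simp add: differentiable_on_def)
    then show "h \<circ> \<gamma> differentiable at s within {-\<epsilon><..<\<epsilon>}"
      by (rule differentiable_chain_within[OF _ differentiableI[OF has_derivative_at_withinI[OF dh]]])
  qed
  moreover have "(h \<circ> \<gamma>) ` {-\<epsilon><..<\<epsilon>} \<subseteq> h ` M"
    using \<gamma>(3) by auto
  moreover have "(h \<circ> \<gamma> has_vector_derivative A *v v) (at 0)"
    by (rule vector_derivative_diff_chain_within[OF \<gamma>(5) has_derivative_at_withinI[OF dh]])
  ultimately have "A *v v \<in> tangent_space (h ` M) (h p)"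
    unfolding tangent_space_def mem_Collect_eq using \<gamma>(1,4)
    by (intro exI[of _ "h \<circ> \<gamma>"] exI[of _ \<epsilon>]) simp
  then show ?thesis by (simp add: h_def)
qed

lemma rotation_matrix_transpose:
  fixes A :: "real^'n^'n"
  assumes "rotation_matrix A"
  shows "transpose A *v (A *v v) = v" "A *v (transpose A *v v) = v"
proof -
  have "transpose A ** A = mat 1" "A ** transpose A = mat 1"
    using assms by (auto simp: rotation_matrix_def orthogonal_matrix_def)
  then show "transpose A *v (A *v v) = v" "A *v (transpose A *v v) = v"
    by (simp_all add: matrix_vector_mul_assoc del: transpose_matrix_vector)
qed

lemma tangent_space_Isom_plus_image:
  assumes "g \<in> Isom_plus"
  shows "tangent_space (g ` M) (g p) = (*v) (linear_part g) ` tangent_space M p"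
proof -
  define A where "A = linear_part g"
  define r where "r = g 0"
  have A: "rotation_matrix A"
    unfolding A_def by (rule Isom_plus_linear_part(1)[OF assms])
  have g: "g = (\<lambda>p. A *v p + r)"
    unfolding A_def r_def by (rule ext) (rule Isom_plus_linear_part(2)[OF assms])
  \<comment> \<open>The inverse of \<open>g\<close>, written in affine form so that the inclusion
    for affine images applies to it.\<close>
  define h where "h q = transpose A *v q + - (transpose A *v r)" for q
  have hg: "h (g q) = q" for q
    by (simp add: h_def g matrix_vector_right_distrib rotation_matrix_transpose[OF A]
        del: transpose_matrix_vector)
  have "tangent_space (g ` M) (g p) \<subseteq> (*v) A ` tangent_space M p"
  proof
    fix v assume "v \<in> tangent_space (g ` M) (g p)"
    then have "transpose A *v v \<in> tangent_space (h ` (g ` M)) (h (g p))"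
      unfolding h_def by (rule tangent_space_affine_image_subset)
    then have "transpose A *v v \<in> tangent_space M p"
      by (simp add: hg image_image)
    then show "v \<in> (*v) A ` tangent_space M p"
      using rotation_matrix_transpose(2)[OF A, of v] by (metis imageI)
  qed
  moreover have "(*v) A ` tangent_space M p \<subseteq> tangent_space (g ` M) (g p)"
    unfolding g by (auto intro: tangent_space_affine_image_subset)
  ultimately show ?thesis unfolding A_def by blast
qed

text \<open>On the right each field has its own null set. For the converse, countably many spanning
  sections share one null set, and off it linearity passes from them to all of
  \<open>S (x t)\<close>. Keeping \<open>S\<close> and \<open>W\<close> abstract lets one proof
  serve the tangent and the normal case.\<close>

lemma AE_sections_iff:
  fixes x :: "real \<Rightarrow> 'a::euclidean_space" and D :: "real \<Rightarrow> 'a \<Rightarrow> 'b::real_vector"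
  assumes x: "abs_continuous_on 0 \<tau> x" "\<And>t. t \<in> {0..\<tau>} \<Longrightarrow> x t \<in> M"
    and frame: "\<exists>\<E>. countable \<E> \<and> (\<forall>E\<in>\<E>. lipschitz_section M S E) \<and>
      (\<forall>q\<in>M. S q \<subseteq> span ((\<lambda>E. E q) ` \<E>))"
    and D: "\<And>t. linear (D t)" and W: "\<And>t. t \<in> {0..\<tau>} \<Longrightarrow> subspace (W t)"
  shows "(AE t in lebesgue_on {0..\<tau>}. D t ` S (x t) \<subseteq> W t) \<longleftrightarrow>
    (\<forall>Z. abs_continuous_on 0 \<tau> Z \<and> (\<forall>t\<in>{0..\<tau>}. Z t \<in> S (x t)) \<longrightarrow>
      (AE t in lebesgue_on {0..\<tau>}. D t (Z t) \<in> W t))"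
proof (intro iffI allI impI)
  fix Z assume Z: "abs_continuous_on 0 \<tau> Z \<and> (\<forall>t\<in>{0..\<tau>}. Z t \<in> S (x t))"
  assume "AE t in lebesgue_on {0..\<tau>}. D t ` S (x t) \<subseteq> W t"
  then show "AE t in lebesgue_on {0..\<tau>}. D t (Z t) \<in> W t"
  proof (rule AE_mp, intro AE_I2 impI)
    fix t assume "t \<in> space (lebesgue_on {0..\<tau>})" "D t ` S (x t) \<subseteq> W t"
    then show "D t (Z t) \<in> W t" using Z by auto
  qed
next
  assume R: "\<forall>Z. abs_continuous_on 0 \<tau> Z \<and> (\<forall>t\<in>{0..\<tau>}. Z t \<in> S (x t)) \<longrightarrow>
      (AE t in lebesgue_on {0..\<tau>}. D t (Z t) \<in> W t)"
  obtain \<E> where \<E>: "countable \<E>" "\<forall>E\<in>\<E>. lipschitz_section M S E"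
      "\<forall>q\<in>M. S q \<subseteq> span ((\<lambda>E. E q) ` \<E>)"
    using frame by blast
  have "AE t in lebesgue_on {0..\<tau>}. \<forall>E\<in>\<E>. D t (E (x t)) \<in> W t"
  proof (rule AE_ball_countable'[OF _ \<E>(1)])
    fix E assume "E \<in> \<E>"
    then have "lipschitz_section M S E" using \<E>(2) by blast
    then obtain C where C: "C-lipschitz_on UNIV E" and E: "\<And>q. q \<in> M \<Longrightarrow> E q \<in> S q"
      unfolding lipschitz_section_def by blast
    have "abs_continuous_on 0 \<tau> (\<lambda>t. E (x t))"
    proof (rule abs_continuous_on_dominated[OF x(1)])
      fix u v
      have "dist (E (x u)) (E (x v)) \<le> C * dist (x u) (x v)"
        by (rule lipschitz_onD[OF C]) auto
      also have "\<dots> \<le> C * (\<bar>u - v\<bar> + dist (x u) (x v))"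
        using lipschitz_on_nonneg[OF C] by (intro mult_left_mono) auto
      finally show "dist (E (x u)) (E (x v)) \<le> C * (\<bar>u - v\<bar> + dist (x u) (x v))" .
    qed
    then show "AE t in lebesgue_on {0..\<tau>}. D t (E (x t)) \<in> W t"
      using R[rule_format, of "\<lambda>t. E (x t)"] x(2) E by blast
  qed
  then show "AE t in lebesgue_on {0..\<tau>}. D t ` S (x t) \<subseteq> W t"
  proof (rule AE_mp, intro AE_I2 impI)
    fix t assume "t \<in> space (lebesgue_on {0..\<tau>})" and EW: "\<forall>E\<in>\<E>. D t (E (x t)) \<in> W t"
    then have t: "t \<in> {0..\<tau>}" by simp
    \<comment> \<open>The vectors that \<open>D t\<close> sends into \<open>W t\<close> form a
      subspace, so testing a spanning family is enough.\<close>
    have "span ((\<lambda>E. E (x t)) ` \<E>) \<subseteq> D t -` W t"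
      using EW linear_subspace_vimage[OF D W[OF t]] by (intro span_minimal) auto
    then show "D t ` S (x t) \<subseteq> W t"
      using \<E>(3) x(2)[OF t] by blast
  qed
qed

text \<open>By orthogonality \<open>inv g\<close> is affine with linear part
  \<open>transpose (linear_part g)\<close>; the linear part of the composite is read off its
  explicit form.\<close>

lemma linear_part_comp_inv_Isom_plus:
  fixes B :: "real^'N^'N"
  assumes "g \<in> Isom_plus"
  shows "linear_part ((\<lambda>p. B *v p + c) \<circ> inv g) = B ** transpose (linear_part g)"
    and "inv g (g p) = p"
proof -
  define A where "A = linear_part g"
  have A: "rotation_matrix A" and g: "\<And>p. g p = A *v p + g 0"
    unfolding A_def by (rule Isom_plus_linear_part(1)[OF assms], rule Isom_plus_linear_part(2)[OF assms])
  have inj: "inj g"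
  proof (rule injI)
    fix p q assume "g p = g q"
    then have "A *v p = A *v q" using g[of p] g[of q] by simp
    then show "p = q" using rotation_matrix_transpose(1)[OF A] by metis
  qed
  then show "inv g (g p) = p" by (rule inv_f_f)
  have "g (transpose A *v (q - g 0)) = q" for q
    by (subst g) (simp add: rotation_matrix_transpose[OF A]
        del: transpose_matrix_vector)
  then have "inv g q = transpose A *v (q - g 0)" for q
    using inv_f_f[OF inj] by metis
  then have "(\<lambda>p. B *v p + c) \<circ> inv g =
      (\<lambda>q. (B ** transpose A) *v q + (c - (B ** transpose A) *v g 0))"
    by (simp add: fun_eq_iff matrix_vector_mul_assoc[symmetric] matrix_vector_mult_diff_distrib
        del: transpose_matrix_vector)
  then show "linear_part ((\<lambda>p. B *v p + c) \<circ> inv g) = B ** transpose (linear_part g)"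
    by (simp add: A_def)
qed

text \<open>The terms coming from the derivative of \<open>Z\<close> cancel because
  \<open>A t\<close> carries one splitting to the other. What remains says that the tangential part,
  in the second claim the normal part, of \<open>A' *v Z t\<close> is 0.\<close>

lemma covariant_derivative_commutes_iff:
  fixes A :: "real \<Rightarrow> real^'N^'N"
  assumes t: "t \<in> {0<..<\<tau>}"
    and A: "(A has_vector_derivative A') (at t)" "rotation_matrix (A t)"
    and Z: "Z differentiable (at t)"
    and T: "subspace (tangent_space M (x t))"
      "(*v) (A t) ` tangent_space M (x t) = tangent_space M' (y t)"
  shows "A t *v covariant_derivative M \<tau> x Z t = covariant_derivative M' \<tau> y (\<lambda>s. A s *v Z s) t
      \<longleftrightarrow> A' *v Z t \<in> normal_space_at M' (y t)"
    and "A t *v normal_covariant_derivative M \<tau> x Z t = normal_covariant_derivative M' \<tau> y (\<lambda>s. A s *v Z s) t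
      \<longleftrightarrow> A' *v Z t \<in> tangent_space M' (y t)"
proof -
  have at: "at t within {0..\<tau>} = at t"
    using t by (intro at_within_Icc_at) auto
  define z where "z = vector_derivative Z (at t)"
  have dZ: "(Z has_vector_derivative z) (at t)"
    using Z unfolding z_def by (simp add: vector_derivative_works)
  have dAZ: "vector_derivative (\<lambda>s. A s *v Z s) (at t) = A t *v z + A' *v Z t"
    by (rule vector_derivative_at[OF has_vector_derivative_matrix_vector_mult[OF A(1) dZ]])
  have orth: "orthogonal_transformation ((*v) (A t))"
    using A(2) by (simp add: orthogonal_transformation_matrix rotation_matrix_def)
  have T': "subspace (tangent_space M' (y t))"
    unfolding T(2)[symmetric] by (rule linear_subspace_image[OF matrix_vector_mul_linear T(1)])
  have part: "tangential_part (tangent_space M' (y t)) (A t *v z + A' *v Z t) =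
      A t *v tangential_part (tangent_space M (x t)) z + tangential_part (tangent_space M' (y t)) (A' *v Z t)"
    unfolding tangential_part_add[OF T'] unfolding T(2)[symmetric]
    by (simp add: tangential_part_orthogonal_image[OF orth T(1)])
  show "A t *v covariant_derivative M \<tau> x Z t = covariant_derivative M' \<tau> y (\<lambda>s. A s *v Z s) t
      \<longleftrightarrow> A' *v Z t \<in> normal_space_at M' (y t)"
    unfolding covariant_derivative_def at dAZ part z_def[symmetric]
    using tangential_part_eq_0_iff[OF T', of "A' *v Z t"] by auto
  show "A t *v normal_covariant_derivative M \<tau> x Z t = normal_covariant_derivative M' \<tau> y (\<lambda>s. A s *v Z s) t
      \<longleftrightarrow> A' *v Z t \<in> tangent_space M' (y t)"
    unfolding normal_covariant_derivative_def normal_part_def at dAZ part z_def[symmetric]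
    using tangential_part_eq_self_iff[OF T', of "A' *v Z t"]
    by (auto simp: matrix_vector_mult_diff_distrib)
qed

section \<open>Comparison of the two sets of conditions\<close>

lemma AE_cong_weak:
  assumes "AE t in N. P t \<longleftrightarrow> Q t"
  shows "(AE t in N. P t) \<longleftrightarrow> (AE t in N. Q t)"
  using assms by (intro iffI; elim AE_mp; elim AE_mp) auto

theorem lemma1:
  fixes M M' :: "(real^'N) set"
    and Or Or' :: "real^'N \<Rightarrow> (real^'N) list set"
    and n \<nu> :: nat
    and \<tau> :: real
    and x xh :: "real \<Rightarrow> real^'N"
    and g :: "real \<Rightarrow> real^'N \<Rightarrow> real^'N"
  assumes "CARD('N) = n + \<nu>"
    and "embedded_submanifold n M" and "connected M" and "orientation_on M Or"
    and "embedded_submanifold n M'" and "connected M'" and "orientation_on M' Or'"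
    and "0 \<le> \<tau>"
    and "\<And>t. t \<in> {0..\<tau>} \<Longrightarrow> x t \<in> M"
    and "\<And>t. t \<in> {0..\<tau>} \<Longrightarrow> g t \<in> Isom_plus"
    and "abs_continuous_on 0 \<tau> (\<lambda>t. (x t, linear_part (g t), g t 0))"
    and "xh = (\<lambda>t. g t (x t))"
  shows
    "((\<forall>t\<in>{0..\<tau>}. xh t \<in> M') \<and>
      (\<forall>t\<in>{0..\<tau>}. tangent_space (g t ` M) (xh t) = tangent_space M' (xh t)) \<and>
      (AE t in lebesgue_on {0..\<tau>}. (motion_velocity \<tau> g t \<circ> inv (g t)) (xh t) = 0) \<and>
      (AE t in lebesgue_on {0..\<tau>}.
         (*v) (linear_part (motion_velocity \<tau> g t \<circ> inv (g t))) ` tangent_space M' (xh t)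
           \<subseteq> normal_space_at M' (xh t)) \<and>
      (AE t in lebesgue_on {0..\<tau>}.
         (*v) (linear_part (motion_velocity \<tau> g t \<circ> inv (g t))) ` normal_space_at M' (xh t)
           \<subseteq> tangent_space M' (xh t)) \<and>
      (\<forall>t\<in>{0..\<tau>}. orientation_preserving (tangent_space M (x t)) (Or (x t)) (Or' (xh t))
         ((*v) (linear_part (g t)))))
     \<longleftrightarrow>
     ((\<forall>t\<in>{0..\<tau>}. xh t \<in> M') \<and>
      (\<forall>t\<in>{0..\<tau>}. (*v) (linear_part (g t)) ` tangent_space M (x t) = tangent_space M' (xh t)) \<and>
      (AE t in lebesgue_on {0..\<tau>}.
         vector_derivative xh (at t within {0..\<tau>}) =
         linear_part (g t) *v vector_derivative x (at t within {0..\<tau>})) \<and>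
      (\<forall>Z. tangent_field_along M \<tau> x Z \<longrightarrow>
         (AE t in lebesgue_on {0..\<tau>}.
            linear_part (g t) *v covariant_derivative M \<tau> x Z t =
            covariant_derivative M' \<tau> xh (\<lambda>s. linear_part (g s) *v Z s) t)) \<and>
      (\<forall>\<Psi>. normal_field_along M \<tau> x \<Psi> \<longrightarrow>
         (AE t in lebesgue_on {0..\<tau>}.
            linear_part (g t) *v normal_covariant_derivative M \<tau> x \<Psi> t =
            normal_covariant_derivative M' \<tau> xh (\<lambda>s. linear_part (g s) *v \<Psi> s) t)) \<and>
      (\<forall>t\<in>{0..\<tau>}. orientation_preserving (tangent_space M (x t)) (Or (x t)) (Or' (xh t))
         ((*v) (linear_part (g t)))))"
proof -
  define A where "A t = linear_part (g t)" for t
  define b where "b t = g t 0" for t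
  define T where "T t = tangent_space M (x t)" for t
  define T' where "T' t = tangent_space M' (xh t)" for t
  define A' where "A' t = vector_derivative A (at t)" for t
  \<comment> \<open>All pointwise comparisons are made at such times. Differentiability of a given
    field is added separately, field by field.\<close>
  define good where "good t \<longleftrightarrow> t \<in> {0<..<\<tau>} \<and> x differentiable (at t) \<and> A differentiable (at t) \<and>
    b differentiable (at t)" for t
  have M: "embedded_submanifold n M" using assms(2) .
  have xM: "x t \<in> M" if "t \<in> {0..\<tau>}" for t
    using assms(9) that .
  have g: "g t \<in> Isom_plus" if "t \<in> {0..\<tau>}" for t
    using assms(10) that .
  have A: "rotation_matrix (A t)" if "t \<in> {0..\<tau>}" for t
    unfolding A_def by (rule Isom_plus_linear_part(1)[OF g[OF that]])
  have orth: "orthogonal_transformation ((*v) (A t))" if "t \<in> {0..\<tau>}" for t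
    using A[OF that] by (simp add: orthogonal_transformation_matrix rotation_matrix_def)
  have g_eq: "g t p = A t *v p + b t" if "t \<in> {0..\<tau>}" for t p
    unfolding A_def b_def by (rule Isom_plus_linear_part(2)[OF g[OF that]])
  have xh: "xh t = g t (x t)" for t
    using assms(12) by simp
  have sub_T: "subspace (T t)" if "t \<in> {0..\<tau>}" for t
    unfolding T_def by (rule subspace_tangent_space[OF M xM[OF that]])
  have ac: "abs_continuous_on 0 \<tau> (\<lambda>t. (x t, A t, b t))"
    using assms(11) unfolding A_def b_def .
  have acx: "abs_continuous_on 0 \<tau> x"
    by (rule abs_continuous_on_dominated[OF ac, of _ 1])
      (use dist_fst_le[of "(x u, A u, b u)" "(x v, A v, b v)" for u v] in \<open>simp add: add_increasing\<close>)
  have acAb: "abs_continuous_on 0 \<tau> (\<lambda>t. (A t, b t))"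
    by (rule abs_continuous_on_dominated[OF ac, of _ 1])
      (use dist_snd_le[of "(x u, A u, b u)" "(x v, A v, b v)" for u v] in \<open>simp add: add_increasing\<close>)
  have acA: "abs_continuous_on 0 \<tau> A"
    by (rule abs_continuous_on_dominated[OF acAb, of _ 1])
      (use dist_fst_le[of "(A u, b u)" "(A v, b v)" for u v] in \<open>simp add: add_increasing\<close>)
  have acb: "abs_continuous_on 0 \<tau> b"
    by (rule abs_continuous_on_dominated[OF acAb, of _ 1])
      (use dist_snd_le[of "(A u, b u)" "(A v, b v)" for u v] in \<open>simp add: add_increasing\<close>)
  have AE_good: "AE t in lebesgue_on {0..\<tau>}. good t"
    using abs_continuous_on_AE_differentiable[OF acx] abs_continuous_on_AE_differentiable[OF acA]
      abs_continuous_on_AE_differentiable[OF acb]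
    unfolding good_def by eventually_elim blast
  have goodD: "t \<in> {0..\<tau>}" "at t within {0..\<tau>} = at t" "(A has_vector_derivative A' t) (at t)"
    "motion_velocity \<tau> g t = (\<lambda>p. A' t *v p + vector_derivative b (at t))" if "good t" for t
  proof -
    show "t \<in> {0..\<tau>}" using that by (simp add: good_def)
    show at: "at t within {0..\<tau>} = at t"
      using that by (intro at_within_Icc_at) (auto simp: good_def)
    show "(A has_vector_derivative A' t) (at t)"
      using that unfolding A'_def good_def by (simp add: vector_derivative_works)
    show "motion_velocity \<tau> g t = (\<lambda>p. A' t *v p + vector_derivative b (at t))"
      unfolding motion_velocity_def at A'_def A_def b_def by (rule refl)
  qed
  have ii: "tangent_space (g t ` M) (xh t) = (*v) (A t) ` T t" if "t \<in> {0..\<tau>}" for t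
    unfolding xh A_def T_def by (rule tangent_space_Isom_plus_image[OF g[OF that]])
  have iii: "(motion_velocity \<tau> g t \<circ> inv (g t)) (xh t) = 0 \<longleftrightarrow>
      vector_derivative xh (at t within {0..\<tau>}) = A t *v vector_derivative x (at t within {0..\<tau>})"
    if good: "good t" for t
  proof -
    have dx: "(x has_vector_derivative vector_derivative x (at t)) (at t)"
      and db: "(b has_vector_derivative vector_derivative b (at t)) (at t)"
      using good unfolding good_def by (simp_all add: vector_derivative_works)
    have "((\<lambda>s. A s *v x s + b s) has_vector_derivative
        (A t *v vector_derivative x (at t) + A' t *v x t) + vector_derivative b (at t)) (at t)"
      by (intro has_vector_derivative_add has_vector_derivative_matrix_vector_mult goodD(3)[OF good] dx db)
    \<comment> \<open>\<open>xh\<close> is known to have the affine form only for times in the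
      interval, so the derivative is transferred on its interior.\<close>
    then have "(xh has_vector_derivative
        (A t *v vector_derivative x (at t) + A' t *v x t) + vector_derivative b (at t)) (at t)"
      by (rule has_vector_derivative_transform_within_open[of _ _ _ "{0<..<\<tau>}"])
        (use good in \<open>auto simp: good_def xh g_eq\<close>)
    then have "vector_derivative xh (at t) =
        A t *v vector_derivative x (at t) + (A' t *v x t + vector_derivative b (at t))"
      by (simp add: vector_derivative_at add.assoc)
    moreover have "(motion_velocity \<tau> g t \<circ> inv (g t)) (xh t) = A' t *v x t + vector_derivative b (at t)"
      unfolding goodD(4)[OF good] xh
      by (simp add: linear_part_comp_inv_Isom_plus(2)[OF g[OF goodD(1)[OF good]]])
    ultimately show ?thesis
      unfolding goodD(2)[OF good] by simp
  qed
  \<comment> \<open>The linear part of the composite is \<open>A' t ** transpose (A t)\<close>,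
    which acts on \<open>A t *v v\<close> as \<open>A' t\<close> acts on \<open>v\<close>. This
    moves (iv) and (v) from the spaces along \<open>xh\<close> to those along
    \<open>x\<close>.\<close>
  have lin: "(*v) (linear_part (motion_velocity \<tau> g t \<circ> inv (g t))) ` ((*v) (A t) ` S) = (*v) (A' t) ` S"
    if good: "good t" for t S
  proof -
    note t = goodD(1)[OF good]
    have "linear_part (motion_velocity \<tau> g t \<circ> inv (g t)) = A' t ** transpose (A t)"
      unfolding goodD(4)[OF good] A_def by (rule linear_part_comp_inv_Isom_plus(1)[OF g[OF t]])
    then have "linear_part (motion_velocity \<tau> g t \<circ> inv (g t)) *v (A t *v v) = A' t *v v" for v
      using rotation_matrix_transpose(1)[OF A[OF t], of v]
      by (simp add: matrix_vector_mul_assoc[symmetric] del: transpose_matrix_vector)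
    then show ?thesis by (simp add: image_image)
  qed
  show ?thesis (is "?M' \<and> ?ii \<and> ?iii \<and> ?iv \<and> ?v \<and> ?or \<longleftrightarrow> ?M' \<and> ?ii' \<and> ?iii' \<and> ?iv' \<and> ?v' \<and> ?or")
  proof -
    \<comment> \<open>(iv) and (v) are compared with their counterparts only once the spaces match,
      so \<open>a'\<close>, which stands for (ii'), is available in that comparison.\<close>
    have conj_iff: "m \<and> a \<and> b \<and> c \<and> d \<and> e \<longleftrightarrow> m \<and> a' \<and> b' \<and> c' \<and> d' \<and> e"
      if "a \<longleftrightarrow> a'" "b \<longleftrightarrow> b'" "a' \<Longrightarrow> (c \<longleftrightarrow> c') \<and> (d \<longleftrightarrow> d')" for m a b c d e a' b' c' d'
      using that by blast
    have "?ii \<longleftrightarrow> ?ii'"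
      using ii unfolding A_def T_def by auto
    moreover have "?iii \<longleftrightarrow> ?iii'"
      unfolding A_def[symmetric]
      by (rule AE_cong_weak, rule AE_mp[OF AE_good], intro AE_I2 impI iii)
    moreover have "(?iv \<longleftrightarrow> ?iv') \<and> (?v \<longleftrightarrow> ?v')" if ?ii'
    proof -
      have T': "(*v) (A t) ` T t = T' t" if "t \<in> {0..\<tau>}" for t
        using \<open>?ii'\<close> that unfolding A_def T_def T'_def by blast
      \<comment> \<open>Since \<open>A t\<close> preserves inner products, normal spaces correspond
        as well; this is used for (v).\<close>
      have N': "(*v) (A t) ` ((T t)\<^sup>\<bottom>) = (T' t)\<^sup>\<bottom>" if "t \<in> {0..\<tau>}" for t
        unfolding T'[OF that, symmetric] by (rule orthogonal_comp_orthogonal_image[OF orth[OF that], symmetric])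
      have sub_T': "subspace (T' t)" if "t \<in> {0..\<tau>}" for t
        unfolding T'[OF that, symmetric] by (rule linear_subspace_image[OF matrix_vector_mul_linear sub_T[OF that]])
      have cov: "A t *v covariant_derivative M \<tau> x Z t = covariant_derivative M' \<tau> xh (\<lambda>s. A s *v Z s) t
          \<longleftrightarrow> A' t *v Z t \<in> (T' t)\<^sup>\<bottom>"
        "A t *v normal_covariant_derivative M \<tau> x Z t = normal_covariant_derivative M' \<tau> xh (\<lambda>s. A s *v Z s) t
          \<longleftrightarrow> A' t *v Z t \<in> T' t" if good: "good t" and Z: "Z differentiable (at t)" for t Z
      proof -
        note t = goodD(1)[OF good]
        have "t \<in> {0<..<\<tau>}" using good by (simp add: good_def)
        then show "A t *v covariant_derivative M \<tau> x Z t = covariant_derivative M' \<tau> xh (\<lambda>s. A s *v Z s) t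
          \<longleftrightarrow> A' t *v Z t \<in> (T' t)\<^sup>\<bottom>"
          unfolding T'_def using goodD(3)[OF good] A[OF t] Z sub_T[OF t, unfolded T_def] T'[OF t, unfolded T_def T'_def]
          by (rule covariant_derivative_commutes_iff(1))
        show "A t *v normal_covariant_derivative M \<tau> x Z t = normal_covariant_derivative M' \<tau> xh (\<lambda>s. A s *v Z s) t
          \<longleftrightarrow> A' t *v Z t \<in> T' t"
          unfolding T'_def using \<open>t \<in> {0<..<\<tau>}\<close> goodD(3)[OF good] A[OF t] Z
            sub_T[OF t, unfolded T_def] T'[OF t, unfolded T_def T'_def]
          by (rule covariant_derivative_commutes_iff(2))
      qed
      \<comment> \<open>Here the null set depends on \<open>Z\<close>. For a fixed field this is
        harmless; the quantifier over fields is left to \<open>AE_sections_iff\<close>.\<close>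
      have AE_cov: "AE t in lebesgue_on {0..\<tau>}. good t \<and> Z differentiable (at t)"
        if "abs_continuous_on 0 \<tau> Z" for Z :: "real \<Rightarrow> real^'N"
        using AE_good abs_continuous_on_AE_differentiable[OF that] by eventually_elim blast
      have "?iv \<longleftrightarrow> (AE t in lebesgue_on {0..\<tau>}. (*v) (A' t) ` tangent_space M (x t) \<subseteq> (T' t)\<^sup>\<bottom>)"
        unfolding T'_def[symmetric] T_def[symmetric]
        by (rule AE_cong_weak, rule AE_mp[OF AE_good], intro AE_I2 impI)
          (simp add: T'[OF goodD(1), symmetric] lin)
      also have "\<dots> \<longleftrightarrow> (\<forall>Z. abs_continuous_on 0 \<tau> Z \<and> (\<forall>t\<in>{0..\<tau>}. Z t \<in> tangent_space M (x t)) \<longrightarrow>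
          (AE t in lebesgue_on {0..\<tau>}. A' t *v Z t \<in> (T' t)\<^sup>\<bottom>))"
        by (rule AE_sections_iff[where S = "tangent_space M" and D = "\<lambda>t. (*v) (A' t)" and W = "\<lambda>t. (T' t)\<^sup>\<bottom>",
              OF acx xM tangent_lipschitz_sections[OF M] matrix_vector_mul_linear
              subspace_orthogonal_comp])
      also have "\<dots> \<longleftrightarrow> ?iv'"
        unfolding tangent_field_along_def A_def[symmetric]
      proof (intro iff_allI imp_cong refl)
        fix Z assume "abs_continuous_on 0 \<tau> Z \<and> (\<forall>t\<in>{0..\<tau>}. Z t \<in> tangent_space M (x t))"
        then have Z: "abs_continuous_on 0 \<tau> Z" by blast
        show "(AE t in lebesgue_on {0..\<tau>}. A' t *v Z t \<in> (T' t)\<^sup>\<bottom>) \<longleftrightarrow>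
          (AE t in lebesgue_on {0..\<tau>}. A t *v covariant_derivative M \<tau> x Z t =
            covariant_derivative M' \<tau> xh (\<lambda>s. A s *v Z s) t)"
          by (rule AE_cong_weak, rule AE_mp[OF AE_cov[OF Z]], intro AE_I2 impI) (simp add: cov)
      qed
      finally have iv: "?iv \<longleftrightarrow> ?iv'" .
      have "?v \<longleftrightarrow> (AE t in lebesgue_on {0..\<tau>}. (*v) (A' t) ` normal_space_at M (x t) \<subseteq> T' t)"
        unfolding T'_def[symmetric] T_def[symmetric]
        by (rule AE_cong_weak, rule AE_mp[OF AE_good], intro AE_I2 impI)
          (simp add: N'[OF goodD(1), symmetric] lin)
      also have "\<dots> \<longleftrightarrow> (\<forall>Z. abs_continuous_on 0 \<tau> Z \<and> (\<forall>t\<in>{0..\<tau>}. Z t \<in> normal_space_at M (x t)) \<longrightarrow>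
          (AE t in lebesgue_on {0..\<tau>}. A' t *v Z t \<in> T' t))"
        by (rule AE_sections_iff[where S = "normal_space_at M" and D = "\<lambda>t. (*v) (A' t)" and W = T',
              OF acx xM normal_lipschitz_sections[OF M] matrix_vector_mul_linear sub_T'])
      also have "\<dots> \<longleftrightarrow> ?v'"
        unfolding normal_field_along_def A_def[symmetric]
      proof (intro iff_allI imp_cong refl)
        fix Z assume "abs_continuous_on 0 \<tau> Z \<and> (\<forall>t\<in>{0..\<tau>}. Z t \<in> normal_space_at M (x t))"
        then have Z: "abs_continuous_on 0 \<tau> Z" by blast
        show "(AE t in lebesgue_on {0..\<tau>}. A' t *v Z t \<in> T' t) \<longleftrightarrow>
          (AE t in lebesgue_on {0..\<tau>}. A t *v normal_covariant_derivative M \<tau> x Z t =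
            normal_covariant_derivative M' \<tau> xh (\<lambda>s. A s *v Z s) t)"
          by (rule AE_cong_weak, rule AE_mp[OF AE_cov[OF Z]], intro AE_I2 impI) (simp add: cov)
      qed
      finally show ?thesis using iv by blast
    qed
    ultimately show ?thesis by (rule conj_iff)
  qed
qed

end
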